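(* Let $\mathbb{k}$ be a field of prime characteristic $p$, $R=\mathbb{k}[x_1,\ldots,x_m]$ and $\mathfrak{m}=(x_1,\ldots,x_m)$. Let $\mathfrak{a}\subseteq\mathfrak{m}$ be a nonzero ideal with term ideal $\mathfrak{a}^\circ$, and let $\boldsymbol{f}=(f_1,\ldots,f_t)$ be a list of minimal generators of $\mathfrak{a}$. Suppose that the splitting polytope $\mathcal{P}_{\boldsymbol{f}}$ has a unique maximal point $\rho=(\rho_1,\ldots,\rho_t)$ with $\rho_i=(\rho_{i,1},\ldots,\rho_{i,l_i})\in\mathbb{R}^{l_i}$, and set for $i\in\{1,\ldots,t\}$ $$S_i=\sup\Big\{\ell\in\mathbb{Z}_{\geq 0}\ \Big|\ \sum_{j=1}^{l_i}\rho_{i,j}^{(e)}\leq p-1\ \text{ for every } 0\leq e\leq \ell\Big\}.$$ Let $I$ be the set of indices $i$ for which $S_i$ is finite. Then: (1) If $I=\emptyset$, then $\operatorname{fpt}(\mathfrak{a})=\operatorname{fpt}(\mathfrak{a}^\circ)$. (2) If $I\neq\emptyset$, then $$\operatorname{fpt}(\mathfrak{a})\ \geq\ \sum_{i\in\{1,\ldots,t\}\setminus I}|\rho_i|+\sum_{i\in I}\left(|\langle\rho_i\rangle_{S_i}|+\frac{1}{p^{S_i}}\right).$$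
   Context: **$F$-pure threshold.** For a nonzero ideal $\mathfrak{a}\subseteq\mathfrak{m}$, put $\mathfrak{m}^{[p^e]}=(x_1^{p^e},\ldots,x_m^{p^e})$, $\nu_{\mathfrak{a}}(p^e)=\max\{c\in\mathbb{Z}_{\geq0}\mid \mathfrak{a}^c\not\subseteq\mathfrak{m}^{[p^e]}\}$ and $\operatorname{fpt}(\mathfrak{a})=\lim_{e\to\infty}\nu_{\mathfrak{a}}(p^e)/p^e$ (the limit is known to exist). **Term ideal.** For a polynomial $f=\sum_a c_a x^a$, $\operatorname{Supp}(f)=\{a\in\mathbb{Z}_{\ge0}^m\mid c_a\neq0\}$. For a nonzero ideal $\mathfrak{a}\subseteq\mathfrak{m}$, the Newton polyhedron $\mathcal{N}_{\mathfrak{a}}$ is the convex hull of $\bigcup_{a\in A}(a+\mathbb{R}_{\ge0}^m)$ with $A=\bigcup_{f\in\mathfrak{a}}\operatorname{Supp}(f)$. The term ideal $\mathfrak{a}^\circ$ is the monomial ideal generated by all $x^a$ with $a\in\mathcal{N}_{\mathfrak{a}}$ ($a\in\mathbb{Z}^m_{\ge 0}$). **$p$-expansions.** Every $\alpha\in(0,1]$ is written uniquely as $\alpha=\sum_{k\ge1}\alpha^{(k)}/p^k$ with integers $0\le\alpha^{(k)}\le p-1$ such that the sequence $(\alpha^{(k)})_{k\ge1}$ is not eventually $0$ (nonterminating expansion). Put $\langle\alpha\rangle_e=\sum_{k=1}^e\alpha^{(k)}/p^k$, $\alpha^{(0)}=\langle\alpha\rangle_0=0$, $\langle\alpha\rangle_\infty=\alpha$;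 for $\alpha=0$ all digits and truncations are $0$. For a vector $\alpha\in[0,1]^l$, $\langle\alpha\rangle_e$ is taken entrywise, and for $\alpha\in\mathbb{R}^l$, $|\alpha|$ is the sum of the entries of $\alpha$. **Splitting polytope.** Let $\boldsymbol{f}=(f_1,\ldots,f_t)$ with $f_i\in\mathfrak{m}$. Put $\hat f_1=f_1$ and, for $i\ge2$, let $\hat f_i$ be obtained from $f_i$ by removing all terms whose monomial already appears (with any nonzero coefficient) in one of $f_1,\ldots,f_{i-1}$. Let $l_i=\operatorname{Card}(\operatorname{Supp}(\hat f_i))$, $N=l_1+\cdots+l_t$, and let $\widehat{\mathcal{E}}_i$ be the $m\times l_i$ matrix whose columns are the elements of $\operatorname{Supp}(\hat f_i)$. The exponent matrix is $\mathcal{E}_{\boldsymbol{f}}=(\widehat{\mathcal{E}}_1\mid\cdots\mid\widehat{\mathcal{E}}_t)$ (size $m\times N$). If $l_i=0$, then $f_i$ contributes no columns (the $i$-th block is empty, $|\rho_i|=0$). With $\preceq$ the componentwise order and $\mathbf{1}_m=(1,\ldots,1)\in\mathbb{R}^m$, the splitting polytope is $$\mathcal{P}_{\boldsymbol{f}}=\{\gamma\in\mathbb{R}_{\ge0}^N\mid \mathcal{E}_{\boldsymbol{f}}\cdot\gamma\preceq\mathbf{1}_m\}\subseteq[0,1]^N.$$ A maximal point of $\mathcal{P}_{\boldsymbol{f}}$ is a point at which $\gamma\mapsto|\gamma|$ attains its maximum on $\mathcal{P}_{\boldsymbol{f}}$. Points of $\mathcal{P}_{\boldsymbol{f}}$ are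 written in blocks according to $\mathbb{R}^N=\mathbb{R}^{l_1}\times\cdots\times\mathbb{R}^{l_t}$. *)

theory Defs
  imports "HOL-Analysis.Analysis" "HOL-Library.Poly_Mapping" "HOL-Library.Extended_Nat"
    "HOL-Computational_Algebra.Computational_Algebra"
begin

text \<open>
  The polynomial ring in \<open>m = CARD('n)\<close> variables over \<open>'k\<close> is the monoid algebra
  of the exponent monoid \<open>nat ^ 'n\<close>; the support of a polynomial is its set of \<open>keys\<close>.
\<close>

type_synonym ('n, 'k) mpol = "(nat ^ 'n) \<Rightarrow>\<^sub>0 'k"

definition monomial :: "nat ^ 'n::finite \<Rightarrow> ('n, 'k::field) mpol" where
  "monomial a = Poly_Mapping.single a 1"

definition var :: "'n::finite \<Rightarrow> ('n, 'k::field) mpol" where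
  "var i = monomial (axis i 1)"


subsection \<open>Ideals and the F-pure threshold\<close>

text \<open>Viewing a commutative ring as a module over itself, \<open>ideal.subspace I\<close> says that
  \<open>I\<close> is an ideal and \<open>ideal.span S\<close> is the ideal generated by \<open>S\<close>.\<close>

interpretation ideal: module "(*) :: 'a::comm_ring_1 \<Rightarrow> 'a \<Rightarrow> 'a"
  by unfold_locales (simp_all add: algebra_simps)

primrec ideal_power :: "'a::comm_ring_1 set \<Rightarrow> nat \<Rightarrow> 'a set" where
  "ideal_power I 0 = UNIV"
| "ideal_power I (Suc n) = ideal.span {x * y |x y. x \<in> I \<and> y \<in> ideal_power I n}"

definition max_ideal :: "('n::finite, 'k::field) mpol set" where
  "max_ideal = ideal.span (range var)"

definition bracket_power :: "nat \<Rightarrow> ('n::finite, 'k::field) mpol set" where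
  "bracket_power q = ideal.span (range (\<lambda>i. var i ^ q))"

text \<open>For an ideal contained in \<open>max_ideal\<close> and \<open>q \<ge> 1\<close> the set below is finite and contains 0.\<close>

definition nu :: "('n::finite, 'k::field) mpol set \<Rightarrow> nat \<Rightarrow> nat" where
  "nu I q = Max {c. \<not> ideal_power I c \<subseteq> bracket_power q}"

definition fpt :: "nat \<Rightarrow> ('n::finite, 'k::field) mpol set \<Rightarrow> real" where
  "fpt p I = lim (\<lambda>e. real (nu I (p ^ e)) / real (p ^ e))"


subsection \<open>Newton polyhedron and term ideal\<close>

definition real_vec :: "nat ^ 'n \<Rightarrow> real ^ 'n" where
  "real_vec a = (\<chi> i. real (a $ i))"

definition newton_polyhedron :: "('n::finite, 'k::field) mpol set \<Rightarrow> (real ^ 'n) set" where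
  "newton_polyhedron I =
     convex hull (\<Union>a \<in> (\<Union>f\<in>I. Poly_Mapping.keys f). {real_vec a + v |v. \<forall>i. 0 \<le> v $ i})"

definition term_ideal :: "('n::finite, 'k::field) mpol set \<Rightarrow> ('n, 'k) mpol set" where
  "term_ideal I = ideal.span (monomial ` {a. real_vec a \<in> newton_polyhedron I})"

text \<open>Irredundant lists of generators: no entry can be omitted.\<close>

definition minimal_generators :: "'a::comm_ring_1 list \<Rightarrow> 'a set \<Rightarrow> bool" where
  "minimal_generators fs I \<longleftrightarrow>
     ideal.span (set fs) = I \<and>
     (\<forall>i<length fs. ideal.span {fs ! j |j. j < length fs \<and> j \<noteq> i} \<noteq> I)"


subsection \<open>Nonterminating base-p expansions\<close>

definition nonterminating_expansion :: "nat \<Rightarrow> real \<Rightarrow> (nat \<Rightarrow> nat) \<Rightarrow> bool" where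
  "nonterminating_expansion p \<alpha> d \<longleftrightarrow>
     d 0 = 0 \<and> (\<forall>k. d k \<le> p - 1) \<and> \<not> eventually (\<lambda>k. d k = 0) sequentially \<and>
     (\<lambda>k. real (d k) / real p ^ k) sums \<alpha>"

text \<open>For \<open>0 < \<alpha> \<le> 1\<close> and \<open>p \<ge> 2\<close> the expansion exists and is unique.\<close>

definition digit :: "nat \<Rightarrow> real \<Rightarrow> nat \<Rightarrow> nat" where
  "digit p \<alpha> k = (if \<alpha> = 0 then 0 else (THE d. nonterminating_expansion p \<alpha> d) k)"

definition truncation :: "nat \<Rightarrow> nat \<Rightarrow> real \<Rightarrow> real" where
  "truncation p e \<alpha> = (\<Sum>k=1..e. real (digit p \<alpha> k) / real p ^ k)"


subsection \<open>Splitting polytope\<close>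

text \<open>List positions, hence block indices, start at 0.\<close>

definition hat :: "('n::finite, 'k::field) mpol list \<Rightarrow> nat \<Rightarrow> ('n, 'k) mpol" where
  "hat fs i =
     (\<Sum>a \<in> Poly_Mapping.keys (fs ! i) - (\<Union>j<i. Poly_Mapping.keys (fs ! j)).
        Poly_Mapping.single a (Poly_Mapping.lookup (fs ! i) a))"

text \<open>
  A column of the exponent matrix is identified by its block \<open>i\<close> and the element
  \<open>a\<close> of the support of \<open>hat fs i\<close> it consists of. Thus the space of \<open>N\<close>-tuples is the
  space of real functions on \<open>columns fs\<close>, taken to be \<open>undefined\<close> outside \<open>columns fs\<close>;
  no ordering of the columns within a block is chosen.
\<close>

definition columns :: "('n::finite, 'k::field) mpol list \<Rightarrow> (nat \<times> (nat ^ 'n)) set" where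
  "columns fs = (SIGMA i : {..<length fs}. Poly_Mapping.keys (hat fs i))"

definition exponent_matrix :: "'n::finite \<Rightarrow> nat \<times> (nat ^ 'n) \<Rightarrow> real" where
  "exponent_matrix r c = real (snd c $ r)"

definition splitting_polytope ::
    "('n::finite, 'k::field) mpol list \<Rightarrow> (nat \<times> (nat ^ 'n) \<Rightarrow> real) set" where
  "splitting_polytope fs =
     {\<gamma> \<in> columns fs \<rightarrow>\<^sub>E {0..}. \<forall>r. (\<Sum>c\<in>columns fs. exponent_matrix r c * \<gamma> c) \<le> 1}"

definition maximal_points ::
    "('n::finite, 'k::field) mpol list \<Rightarrow> (nat \<times> (nat ^ 'n) \<Rightarrow> real) set" where
  "maximal_points fs =
     {\<gamma>. is_arg_max (\<lambda>\<gamma>. \<Sum>c\<in>columns fs. \<gamma> c) (\<lambda>\<gamma>. \<gamma> \<in> splitting_polytope fs) \<gamma>}"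

text \<open>The sum of the entries of \<open>\<gamma>\<close> in block \<open>i\<close>.\<close>

definition block_sum ::
    "('n::finite, 'k::field) mpol list \<Rightarrow> (nat \<times> (nat ^ 'n) \<Rightarrow> 'b::comm_monoid_add) \<Rightarrow> nat \<Rightarrow> 'b" where
  "block_sum fs \<gamma> i = (\<Sum>a\<in>Poly_Mapping.keys (hat fs i). \<gamma> (i, a))"

definition carry_bound ::
    "nat \<Rightarrow> ('n::finite, 'k::field) mpol list \<Rightarrow> (nat \<times> (nat ^ 'n) \<Rightarrow> real) \<Rightarrow> nat \<Rightarrow> enat" where
  "carry_bound p fs \<rho> i =
     Sup (enat ` {l. \<forall>e\<le>l. block_sum fs (\<lambda>c. digit p (\<rho> c) e) i \<le> p - 1})"

definition finite_indices ::
    "nat \<Rightarrow> ('n::finite, 'k::field) mpol list \<Rightarrow> (nat \<times> (nat ^ 'n) \<Rightarrow> real) \<Rightarrow> nat set" where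
  "finite_indices p fs \<rho> = {i. i < length fs \<and> carry_bound p fs \<rho> i \<noteq> \<infinity>}"

end

theory Submission
  imports Defs
begin

text \<open>
  Let \<open>A\<close> be the set of all exponents occurring in the generators. Its elements are the
  columns of the exponent matrix, each column belonging to the first generator that
  contains it, so a point of the splitting polytope is a weight function \<open>w\<close> on \<open>A\<close> with
  \<open>\<Sum>a. w a * a \<preceq> (1, ..., 1)\<close>, here called a packing. Let \<open>r\<close> be the packing \<open>\<rho>\<close>, the
  one of largest total weight.

  Upper bound. Every exponent in an element of the ideal lies above an element of \<open>A\<close>, and every
  point of the Newton polyhedron lies above a convex combination of elements of \<open>A\<close>. An
  exponent occurring in the \<open>c\<close>-th power of the ideal or of its term ideal hence lies above
  \<open>\<Sum>a. w a * a\<close> for some \<open>w \<ge> 0\<close> of total weight \<open>c\<close>. If all its entries are below \<open>q\<close>,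
  then \<open>w / q\<close> is a packing and \<open>c \<le> q * |\<rho>|\<close>. So \<open>nu\<close> is bounded by \<open>q * |\<rho>|\<close> for
  both ideals (\<open>power_bounded_packing\<close>). By Frobenius \<open>p * nu q \<le> nu (p * q)\<close>, so
  the sequence defining the F-pure threshold increases; it converges, to at most \<open>|\<rho>|\<close>.

  Lower bound. Put \<open>q = p ^ e\<close>, let \<open>k\<close> be a vector of natural numbers with \<open>k < q * r\<close>
  at its nonzero entries, and let \<open>n i\<close> be the sum of its \<open>i\<close>-th block. In the product of the
  powers \<open>f i ^ n i\<close> the monomial with exponent \<open>\<Sum>a. k a * a\<close> arises in only one way: another way
  would give a vector \<open>k'\<close> with the same total and the same exponent, and
  \<open>r + (k' - k) / q\<close> would be a second maximal packing; and since the blocks are triangular with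
  respect to the generators, \<open>k\<close> determines how many factors of each generator contribute each
  exponent. The coefficient is therefore, up to nonzero factors of the field, a product of
  multinomial coefficients, one for each block, and by Legendre's formula it is nonzero if adding up the
  entries of a block in base \<open>p\<close> causes no carry. Since all entries of \<open>\<Sum>a. k a * a\<close> are below
  \<open>q\<close>, the total of \<open>k\<close> is a lower bound for \<open>nu q\<close> (\<open>sum_le_nu\<close>).

  It remains to choose \<open>k\<close>. In a block whose digits never carry, take \<open>q\<close> times the truncation
  of \<open>\<rho>\<close>; the error is bounded. In a block with its first carry after position \<open>L\<close>, keep the
  first \<open>L\<close> digits, lower those at position \<open>L + 1\<close> until they add up to \<open>p - 1\<close>, and put
  \<open>p - 1\<close> at all later positions of one entry whose digit was lowered: that entry
  stays below \<open>\<rho>\<close>, and the digits after \<open>L\<close> contribute \<open>1 / p ^ L - 1 / q\<close>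
  (\<open>exists_carry_free_at_carry\<close>). Letting \<open>e\<close> tend to infinity gives the bound of part (2).
  If no block carries, it gives \<open>|\<rho>|\<close>, which with the upper bound proves part (1).
\<close>

(* The dollar sign is reserved for the components of a vector. *)
no_notation fps_nth (infixl \<open>$\<close> 75)

(* For a ring over itself this rule is associativity read from right to left,
   which loops with mult.assoc and mult_ac. *)
declare ideal.scale_scale [simp del]

section \<open>Multinomial coefficients and carries\<close>

definition compositions :: "'a set \<Rightarrow> nat \<Rightarrow> ('a \<Rightarrow> nat) set" where
  "compositions A n = {\<kappa> \<in> A \<rightarrow>\<^sub>E UNIV. sum \<kappa> A = n}"

definition multinomial :: "'a set \<Rightarrow> ('a \<Rightarrow> nat) \<Rightarrow> nat" where
  "multinomial A \<kappa> = fact (sum \<kappa> A) div (\<Prod>a\<in>A. fact (\<kappa> a))"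

text \<open>
  Needed because the multinomial coefficient is defined by integer division.
\<close>

lemma prod_fact_dvd_fact_sum:
  assumes "finite A"
  shows "(\<Prod>a\<in>A. fact (\<kappa> a)) dvd (fact (sum \<kappa> A) :: nat)"
  using assms
proof (induction A rule: finite_induct)
  case (insert b A)
  have "fact (\<kappa> b) * (\<Prod>a\<in>A. fact (\<kappa> a)) dvd fact (\<kappa> b) * (fact (sum \<kappa> A) :: nat)"
    using insert.IH by (rule mult_dvd_mono[OF dvd_refl])
  also have "\<dots> dvd fact (\<kappa> b + sum \<kappa> A)"
    by (rule fact_fact_dvd_fact)
  finally show ?case using insert.hyps by simp
qed simp

lemma multinomial_mult_prod_fact:
  assumes "finite A"
  shows "multinomial A \<kappa> * (\<Prod>a\<in>A. fact (\<kappa> a)) = fact (sum \<kappa> A)"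
  unfolding multinomial_def using prod_fact_dvd_fact_sum[OF assms] by simp

lemma multinomial_insert:
  assumes "finite A" "b \<notin> A"
  shows "multinomial (insert b A) \<kappa> = (\<kappa> b + sum \<kappa> A choose \<kappa> b) * multinomial A \<kappa>"
proof -
  let ?P = "\<Prod>a\<in>A. fact (\<kappa> a) :: nat"
  have "multinomial (insert b A) \<kappa> * (fact (\<kappa> b) * ?P) = fact (\<kappa> b + sum \<kappa> A)"
    using multinomial_mult_prod_fact[of "insert b A" \<kappa>] assms by simp
  also have "\<dots> = fact (\<kappa> b) * fact (sum \<kappa> A) * (\<kappa> b + sum \<kappa> A choose \<kappa> b)"
    using binomial_fact_lemma[of "\<kappa> b" "\<kappa> b + sum \<kappa> A"] by simp
  also have "fact (sum \<kappa> A) = multinomial A \<kappa> * ?P"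
    using multinomial_mult_prod_fact[OF assms(1)] by simp
  finally have "multinomial (insert b A) \<kappa> * (fact (\<kappa> b) * ?P) =
      ((\<kappa> b + sum \<kappa> A choose \<kappa> b) * multinomial A \<kappa>) * (fact (\<kappa> b) * ?P)"
    by (simp add: mult_ac)
  moreover have "fact (\<kappa> b) * ?P \<noteq> 0"
    using assms(1) by simp
  ultimately show ?thesis by (metis mult_right_cancel)
qed

lemma multinomial_cong:
  assumes "\<And>a. a \<in> A \<Longrightarrow> \<kappa> a = \<mu> a"
  shows "multinomial A \<kappa> = multinomial A \<mu>"
  using assms by (simp add: multinomial_def cong: sum.cong prod.cong)

lemma finite_compositions:
  assumes "finite A"
  shows "finite (compositions A n)"
proof (rule finite_subset)
  show "compositions A n \<subseteq> A \<rightarrow>\<^sub>E {..n}"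
    using assms by (auto simp: compositions_def PiE_iff extensional_def intro: member_le_sum)
  show "finite (A \<rightarrow>\<^sub>E {..n})"
    using assms by (simp add: finite_PiE)
qed

text \<open>
  Induction on the index set: split off one summand by the binomial theorem, and note that a
  composition of \<open>n\<close> on \<open>insert b A\<close> is a value \<open>j\<close> at \<open>b\<close> together with a composition of
  \<open>n - j\<close> on \<open>A\<close>.
\<close>

theorem multinomial_theorem:
  fixes z :: "'a \<Rightarrow> 'b::comm_ring_1"
  assumes "finite A"
  shows "(\<Sum>a\<in>A. z a) ^ n =
    (\<Sum>\<kappa>\<in>compositions A n. of_nat (multinomial A \<kappa>) * (\<Prod>a\<in>A. z a ^ \<kappa> a))"
  using assms
proof (induction A arbitrary: n rule: finite_induct)
  case empty
  have "compositions ({} :: 'a set) n = (if n = 0 then {\<lambda>_. undefined} else {})"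
    by (auto simp: compositions_def)
  then show ?case by (simp add: multinomial_def power_0_left)
next
  case (insert b A)
  define T where "T = (\<lambda>\<kappa>. of_nat (multinomial (insert b A) \<kappa>) * (\<Prod>a\<in>insert b A. z a ^ \<kappa> a))"
  have summand: "of_nat (n choose j) * z b ^ j *
      (of_nat (multinomial A \<kappa>) * (\<Prod>a\<in>A. z a ^ \<kappa> a)) = T (\<kappa>(b := j))"
    if "j \<le> n" "\<kappa> \<in> compositions A (n - j)" for j \<kappa>
  proof -
    have "sum (\<kappa>(b := j)) A = sum \<kappa> A"
      using insert.hyps by (intro sum.cong) auto
    then have s: "sum (\<kappa>(b := j)) A = n - j"
      using that by (simp add: compositions_def del: fun_upd_apply)
    have m: "multinomial A (\<kappa>(b := j)) = multinomial A \<kappa>"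
      using insert.hyps by (intro multinomial_cong) auto
    have pr: "(\<Prod>a\<in>A. z a ^ (\<kappa>(b := j)) a) = (\<Prod>a\<in>A. z a ^ \<kappa> a)"
      using insert.hyps by (intro prod.cong) auto
    have "multinomial (insert b A) (\<kappa>(b := j)) = (n choose j) * multinomial A \<kappa>"
      unfolding multinomial_insert[OF insert.hyps] s m using that(1) by simp
    moreover have "(\<Prod>a\<in>insert b A. z a ^ (\<kappa>(b := j)) a) = z b ^ j * (\<Prod>a\<in>A. z a ^ \<kappa> a)"
      unfolding prod.insert[OF insert.hyps] pr by simp
    ultimately show ?thesis
      unfolding T_def by (simp only: of_nat_mult mult_ac)
  qed
  have "(\<Sum>a\<in>insert b A. z a) ^ n =
      (\<Sum>j\<le>n. of_nat (n choose j) * z b ^ j * (\<Sum>a\<in>A. z a) ^ (n - j))"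
    unfolding sum.insert[OF insert.hyps] by (rule binomial_ring)
  also have "\<dots> = (\<Sum>j\<le>n. \<Sum>\<kappa>\<in>compositions A (n - j). T (\<kappa>(b := j)))"
    unfolding insert.IH sum_distrib_left by (intro sum.cong refl summand) auto
  also have "\<dots> = (\<Sum>(j, \<kappa>)\<in>(SIGMA j:{..n}. compositions A (n - j)). T (\<kappa>(b := j)))"
    using insert.hyps by (simp add: sum.Sigma finite_compositions)
  also have "\<dots> = (\<Sum>\<kappa>\<in>compositions (insert b A) n. T \<kappa>)"
  proof (rule sum.reindex_bij_witness[where i = "\<lambda>\<kappa>. (\<kappa> b, \<kappa>(b := undefined))"
        and j = "\<lambda>(j, \<kappa>). \<kappa>(b := j)"])
    fix x assume "x \<in> (SIGMA j:{..n}. compositions A (n - j))"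
    then obtain j \<kappa> where x: "x = (j, \<kappa>)" "j \<le> n" "\<kappa> \<in> compositions A (n - j)" by auto
    have "sum (\<kappa>(b := j)) A = sum \<kappa> A"
      using insert.hyps by (intro sum.cong) auto
    then show "(case x of (j, \<kappa>) \<Rightarrow> \<kappa>(b := j)) \<in> compositions (insert b A) n"
      using x insert.hyps by (auto simp: compositions_def PiE_iff extensional_def simp del: fun_upd_apply)
        (auto simp: fun_upd_apply)
    show "(((case x of (j, \<kappa>) \<Rightarrow> \<kappa>(b := j)) b), (case x of (j, \<kappa>) \<Rightarrow> \<kappa>(b := j))(b := undefined)) = x"
      using x insert.hyps by (auto simp: compositions_def PiE_iff extensional_def fun_eq_iff)
  next
    fix \<kappa> assume k: "\<kappa> \<in> compositions (insert b A) n"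
    have "sum (\<kappa>(b := undefined)) A = sum \<kappa> A"
      using insert.hyps by (intro sum.cong) auto
    then show "(\<kappa> b, \<kappa>(b := undefined)) \<in> (SIGMA j:{..n}. compositions A (n - j))"
      using k insert.hyps by (auto simp: compositions_def PiE_iff extensional_def)
  qed (auto simp: T_def)
  finally show ?case by (simp add: T_def)
qed

text \<open>
  Legendre's formula in recursive form: among the factors of \<open>n!\<close> only the \<open>n div p\<close>
  multiples of \<open>p\<close> matter, and dividing each of them by \<open>p\<close> leaves \<open>(n div p)!\<close>.
\<close>

lemma multiplicity_fact_div:
  assumes "prime (p::nat)"
  shows "multiplicity p (fact n) = n div p + multiplicity p (fact (n div p))"
proof (induction n)
  case (Suc n)
  have p: "p > 1" using assms prime_gt_1_nat by blast
  have pe: "prime_elem p" using assms by auto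
  have m: "multiplicity p (fact (Suc k)) = multiplicity p (Suc k) + multiplicity p (fact k)" for k
    unfolding fact_Suc of_nat_id using pe by (intro prime_elem_multiplicity_mult_distrib) auto
  show ?case
  proof (cases "p dvd Suc n")
    case True
    then have q: "Suc n div p = Suc (n div p)" "Suc n = p * Suc (n div p)"
      by (metis div_Suc dvd_eq_mod_eq_0, metis div_Suc dvd_eq_mod_eq_0 dvd_mult_div_cancel True)
    have "multiplicity p (Suc n) = Suc (multiplicity p (Suc (n div p)))"
      by (subst q(2)) (use p in \<open>simp add: multiplicity_times_same del: mult_Suc_right\<close>)
    then show ?thesis
      by (simp add: m q(1) Suc.IH del: fact_Suc)
  next
    case False
    then have "Suc n div p = n div p" by (metis div_Suc dvd_eq_mod_eq_0)
    then show ?thesis using False by (simp add: m Suc.IH not_dvd_imp_multiplicity_0 del: fact_Suc)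
  qed
qed simp

text \<open>
  The hypothesis says that adding the numbers \<open>\<kappa> a\<close> in base \<open>p\<close> causes no carry. Then
  division by \<open>p\<close> commutes with the sum and preserves the hypothesis, so
  Legendre's recursion runs in parallel on both sides.
\<close>

lemma multiplicity_fact_sum:
  assumes "prime (p::nat)" "finite A"
    and "\<And>i. (\<Sum>a\<in>A. \<kappa> a mod p ^ i) < p ^ i"
  shows "multiplicity p (fact (sum \<kappa> A)) = (\<Sum>a\<in>A. multiplicity p (fact (\<kappa> a)))"
  using assms(3)
proof (induction "sum \<kappa> A" arbitrary: \<kappa> rule: less_induct)
  case less
  have p: "p > 1" using assms(1) prime_gt_1_nat by blast
  show ?case
  proof (cases "sum \<kappa> A = 0")
    case True
    then show ?thesis using assms(2) by simp
  next
    case False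
    have "sum \<kappa> A = (\<Sum>a\<in>A. p * (\<kappa> a div p) + \<kappa> a mod p)"
      by simp
    also have "\<dots> = p * (\<Sum>a\<in>A. \<kappa> a div p) + (\<Sum>a\<in>A. \<kappa> a mod p)"
      by (simp only: sum.distrib sum_distrib_left)
    finally have d: "sum \<kappa> A div p = (\<Sum>a\<in>A. \<kappa> a div p)"
      using less.prems[of 1] p by simp
    have "(\<Sum>a\<in>A. \<kappa> a div p) < sum \<kappa> A"
      using d False p by (metis div_less_dividend bot_nat_0.not_eq_extremum)
    moreover have "(\<Sum>a\<in>A. \<kappa> a div p mod p ^ i) < p ^ i" for i
    proof -
      have "p * (\<Sum>a\<in>A. \<kappa> a div p mod p ^ i) \<le> (\<Sum>a\<in>A. \<kappa> a mod p ^ Suc i)"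
        unfolding sum_distrib_left
        by (intro sum_mono) (simp add: mod_mult2_eq)
      also have "\<dots> < p ^ Suc i" by (rule less.prems)
      finally show ?thesis using p by simp
    qed
    ultimately have "multiplicity p (fact (\<Sum>a\<in>A. \<kappa> a div p)) =
        (\<Sum>a\<in>A. multiplicity p (fact (\<kappa> a div p)))"
      using less.hyps by blast
    then have "multiplicity p (fact (sum \<kappa> A)) =
        (\<Sum>a\<in>A. \<kappa> a div p + multiplicity p (fact (\<kappa> a div p)))"
      by (subst multiplicity_fact_div[OF assms(1)]) (simp add: d sum.distrib)
    then show ?thesis
      by (simp add: multiplicity_fact_div[OF assms(1), symmetric])
  qed
qed

text \<open>
  One direction of Kummer's theorem, for several summands.
\<close>

lemma not_dvd_multinomial:
  assumes "prime (p::nat)" "finite A"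
    and "\<And>i. (\<Sum>a\<in>A. \<kappa> a mod p ^ i) < p ^ i"
  shows "\<not> p dvd multinomial A \<kappa>"
proof -
  have pe: "prime_elem p" using assms(1) by auto
  have nz: "multinomial A \<kappa> \<noteq> 0"
    using multinomial_mult_prod_fact[OF assms(2), of \<kappa>] by (metis fact_nonzero mult_zero_left)
  have "multiplicity p (fact (sum \<kappa> A)) =
      multiplicity p (multinomial A \<kappa>) + multiplicity p (\<Prod>a\<in>A. fact (\<kappa> a))"
    unfolding multinomial_mult_prod_fact[OF assms(2), symmetric]
    using nz assms(2) pe by (intro prime_elem_multiplicity_mult_distrib) auto
  also have "multiplicity p (\<Prod>a\<in>A. fact (\<kappa> a) :: nat) = (\<Sum>a\<in>A. multiplicity p (fact (\<kappa> a)))"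
    using assms(2) pe by (intro prime_elem_multiplicity_prod_distrib) auto
  finally have "multiplicity p (multinomial A \<kappa>) = 0"
    using multiplicity_fact_sum[OF assms] by simp
  then show ?thesis
    using nz pe by (simp add: prime_elem_multiplicity_eq_zero_iff)
qed

text \<open>
  The terms with \<open>s \<ge> i\<close> are divisible by \<open>p ^ i\<close>, and a remainder is at most the number itself.
\<close>

lemma mod_power_digits_le:
  fixes D :: "nat \<Rightarrow> nat"
  shows "(\<Sum>s<e. D s * p ^ s) mod p ^ i \<le> (\<Sum>s<i. D s * p ^ s)"
proof (cases "i \<le> e")
  case True
  have "(\<Sum>s<e. D s * p ^ s) = (\<Sum>s<i. D s * p ^ s) + (\<Sum>s\<in>{i..<e}. D s * p ^ s)"
    using True by (simp add: lessThan_atLeast0 sum.atLeastLessThan_concat)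
  moreover have "p ^ i dvd (\<Sum>s\<in>{i..<e}. D s * p ^ s)"
    by (intro dvd_sum) (auto intro: dvd_mult le_imp_power_dvd)
  then obtain t where "(\<Sum>s\<in>{i..<e}. D s * p ^ s) = p ^ i * t" ..
  ultimately have "(\<Sum>s<e. D s * p ^ s) mod p ^ i = (\<Sum>s<i. D s * p ^ s) mod p ^ i"
    by simp
  then show ?thesis by simp
next
  case False
  have "(\<Sum>s<e. D s * p ^ s) mod p ^ i \<le> (\<Sum>s<e. D s * p ^ s)" by simp
  also have "\<dots> \<le> (\<Sum>s<i. D s * p ^ s)"
    using False by (intro sum_mono2) auto
  finally show ?thesis .
qed

lemma sum_power_telescope:
  assumes "(p::nat) \<ge> 1"
  shows "(\<Sum>s<i. (p - 1) * p ^ s) + 1 = p ^ i"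
proof (induction i)
  case (Suc i)
  then have "(\<Sum>s<Suc i. (p - 1) * p ^ s) + 1 = p ^ i + (p - 1) * p ^ i" by simp
  also have "\<dots> = p ^ Suc i"
    using assms by (cases p) (auto simp: algebra_simps)
  finally show ?case .
qed simp

text \<open>
  Added up by positions, the lowest \<open>i\<close> digits give at most the number all of whose \<open>i\<close> digits are
  \<open>p - 1\<close>, which is \<open>p ^ i - 1\<close>.
\<close>

lemma sum_mod_power_less_of_digits:
  fixes D :: "'a \<Rightarrow> nat \<Rightarrow> nat"
  assumes "(p::nat) \<ge> 1" "\<And>s. (\<Sum>a\<in>A. D a s) \<le> p - 1"
  shows "(\<Sum>a\<in>A. (\<Sum>s<e. D a s * p ^ s) mod p ^ i) < p ^ i"
proof -
  have "(\<Sum>a\<in>A. (\<Sum>s<e. D a s * p ^ s) mod p ^ i) \<le> (\<Sum>a\<in>A. \<Sum>s<i. D a s * p ^ s)"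
    by (intro sum_mono mod_power_digits_le)
  also have "\<dots> = (\<Sum>s<i. (\<Sum>a\<in>A. D a s) * p ^ s)"
    by (subst sum.swap) (simp add: sum_distrib_right)
  also have "\<dots> \<le> (\<Sum>s<i. (p - 1) * p ^ s)"
    by (intro sum_mono mult_right_mono assms(2)) simp
  also have "\<dots> < p ^ i"
    using sum_power_telescope[OF assms(1), of i] by linarith
  finally show ?thesis .
qed

section \<open>Nonterminating base-p expansions\<close>

text \<open>
  The first inequality is strict because a nonterminating expansion has a nonzero digit beyond
  every position; the second compares the tail with a geometric series.
\<close>

lemma expansion_bounds:
  assumes "p \<ge> 2" "nonterminating_expansion p \<alpha> d"
  shows "(\<Sum>k=1..e. real (d k) / real p ^ k) < \<alpha>"
    and "\<alpha> \<le> (\<Sum>k=1..e. real (d k) / real p ^ k) + 1 / real p ^ e"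
proof -
  define f where "f = (\<lambda>k. real (d k) / real p ^ k)"
  have d: "d 0 = 0" "\<And>k. d k \<le> p - 1" "\<not> eventually (\<lambda>k. d k = 0) sequentially" "f sums \<alpha>"
    using assms(2) unfolding nonterminating_expansion_def f_def by auto
  have head: "(\<Sum>k<Suc e. f k) = (\<Sum>k=1..e. f k)"
    unfolding sum.lessThan_Suc_shift using d(1) by (simp add: f_def sum.atLeast1_atMost_eq)
  have pos: "f k \<ge> 0" for k by (simp add: f_def)
  obtain i where i: "i \<ge> Suc e" "d i \<noteq> 0"
    using d(3) unfolding eventually_sequentially by blast
  then have "0 < f i" using assms(1) by (simp add: f_def)
  then have "(\<Sum>k<Suc e. f k) < suminf f"
    using i(1) pos d(4) by (intro sum_less_suminf2[where i = i]) (auto simp: sums_iff)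
  then show "(\<Sum>k=1..e. real (d k) / real p ^ k) < \<alpha>"
    using head sums_unique[OF d(4)] unfolding f_def by simp
  have tail: "(\<lambda>k. f (k + Suc e)) sums (\<alpha> - (\<Sum>k<Suc e. f k))"
    by (rule sums_split_initial_segment[OF d(4)])
  have p: "real p > 1" using assms(1) by simp
  then have "norm (1 / real p) < 1" by simp
  then have "(\<lambda>k. (1 / real p) ^ k) sums (1 / (1 - 1 / real p))"
    by (rule geometric_sums)
  then have "(\<lambda>k. (real p - 1) / real p ^ Suc e * (1 / real p) ^ k) sums
      ((real p - 1) / real p ^ Suc e * (1 / (1 - 1 / real p)))"
    by (rule sums_mult)
  moreover have "1 - 1 / real p = (real p - 1) / real p"
    using p by (simp add: diff_divide_distrib)
  then have "(real p - 1) / real p ^ Suc e * (1 / (1 - 1 / real p)) = 1 / real p ^ e"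
    using p by simp
  ultimately have geo: "(\<lambda>k. (real p - 1) / real p ^ Suc e * (1 / real p) ^ k) sums (1 / real p ^ e)"
    by simp
  have "f (k + Suc e) \<le> (real p - 1) / real p ^ Suc e * (1 / real p) ^ k" for k
  proof -
    have "real (d (k + Suc e)) \<le> real p - 1"
      using d(2)[of "k + Suc e"] assms(1) by linarith
    then have "f (k + Suc e) \<le> (real p - 1) / real p ^ (Suc e + k)"
      unfolding f_def add.commute[of k] by (rule divide_right_mono) simp
    also have "\<dots> = (real p - 1) / real p ^ Suc e * (1 / real p) ^ k"
      by (simp only: power_add power_one_over times_divide_times_eq mult_1_right)
    finally show ?thesis .
  qed
  then have "\<alpha> - (\<Sum>k<Suc e. f k) \<le> 1 / real p ^ e"
    using tail geo by (rule sums_le)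
  then show "\<alpha> \<le> (\<Sum>k=1..e. real (d k) / real p ^ k) + 1 / real p ^ e"
    using head unfolding f_def by simp
qed

text \<open>
  Digit positions count from the leading end, so \<open>d e\<close> is the units digit: this is \<open>p ^ e\<close> times
  the truncation after \<open>e\<close> digits, as a natural number.
\<close>

definition leading_digits :: "nat \<Rightarrow> (nat \<Rightarrow> nat) \<Rightarrow> nat \<Rightarrow> nat" where
  "leading_digits p d e = (\<Sum>s<e. d (e - s) * p ^ s)"

lemma leading_digits_0 [simp]: "leading_digits p d 0 = 0"
  by (simp add: leading_digits_def)

lemma leading_digits_Suc:
  "leading_digits p d (Suc e) = p * leading_digits p d e + d (Suc e)"
  unfolding leading_digits_def sum.lessThan_Suc_shift
  by (simp add: sum_distrib_left mult_ac)

lemma leading_digits_real: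
  assumes "p \<ge> 1"
  shows "real (leading_digits p d e) = real p ^ e * (\<Sum>k=1..e. real (d k) / real p ^ k)"
proof (induction e)
  case (Suc e)
  then show ?case
    using assms by (simp add: leading_digits_Suc distrib_left mult.assoc)
qed simp

text \<open>
  The leading digits thus form the largest integer strictly below \<open>p ^ e * \<alpha>\<close>, which
  makes the expansion unique and shows how to construct it.
\<close>

lemma leading_digits_bounds:
  assumes "p \<ge> 2" "nonterminating_expansion p \<alpha> d"
  shows "real (leading_digits p d e) < real p ^ e * \<alpha>"
    and "real p ^ e * \<alpha> \<le> real (leading_digits p d e) + 1"
proof -
  have p: "real p ^ e > 0" using assms(1) by simp
  show "real (leading_digits p d e) < real p ^ e * \<alpha>"
    using expansion_bounds(1)[OF assms, of e] p assms(1) by (simp add: leading_digits_real)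
  have "real p ^ e * \<alpha> \<le> real p ^ e * ((\<Sum>k=1..e. real (d k) / real p ^ k) + 1 / real p ^ e)"
    using expansion_bounds(2)[OF assms, of e] p by simp
  also have "\<dots> = real (leading_digits p d e) + 1"
    using assms(1) p by (simp add: leading_digits_real distrib_left)
  finally show "real p ^ e * \<alpha> \<le> real (leading_digits p d e) + 1" .
qed

lemma expansion_unique:
  assumes "p \<ge> 2" "nonterminating_expansion p \<alpha> d" "nonterminating_expansion p \<alpha> d'"
  shows "d = d'"
proof
  have eq: "leading_digits p d e = leading_digits p d' e" for e
    using leading_digits_bounds[OF assms(1,2), of e] leading_digits_bounds[OF assms(1,3), of e]
    by linarith
  show "d k = d' k" for k
  proof (cases k)
    case 0
    then show ?thesis using assms(2,3) by (simp add: nonterminating_expansion_def)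
  next
    case (Suc e)
    then show ?thesis
      using eq[of e] eq[of "Suc e"] by (simp add: leading_digits_Suc)
  qed
qed

lemma expansion_exists:
  assumes "p \<ge> 2" "0 < \<alpha>" "\<alpha> \<le> 1"
  shows "\<exists>d. nonterminating_expansion p \<alpha> d"
proof -
  \<comment> \<open>the number that the first \<open>e\<close> digits have to form, see \<open>leading_digits_bounds\<close>\<close>
  define N where "N = (\<lambda>e. nat (\<lceil>real p ^ e * \<alpha>\<rceil> - 1))"
  have N: "real (N e) < real p ^ e * \<alpha>" "real p ^ e * \<alpha> \<le> real (N e) + 1" for e
  proof -
    have "0 < real p ^ e * \<alpha>" using assms by simp
    then have "\<lceil>real p ^ e * \<alpha>\<rceil> \<ge> 1" by (simp add: le_ceiling_iff)
    then have "real (N e) = real_of_int \<lceil>real p ^ e * \<alpha>\<rceil> - 1"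
      unfolding N_def by simp
    then show "real (N e) < real p ^ e * \<alpha>" "real p ^ e * \<alpha> \<le> real (N e) + 1"
      by linarith+
  qed
  have N0: "N 0 = 0" using N[of 0] assms(3) by simp
  define d where "d = (\<lambda>k. if k = 0 then 0 else N k - p * N (k - 1))"
  have step: "p * N e \<le> N (Suc e)" "N (Suc e) \<le> p * N e + (p - 1)" for e
  proof -
    have "real p * real (N e) < real p * (real p ^ e * \<alpha>)"
      using N(1)[of e] assms(1) by simp
    also have "\<dots> \<le> real (N (Suc e)) + 1" using N(2)[of "Suc e"] by (simp add: mult.assoc)
    finally have "real (p * N e) < real (N (Suc e) + 1)" by simp
    then show "p * N e \<le> N (Suc e)" unfolding of_nat_less_iff by simp
    have "real (N (Suc e)) < real p * (real p ^ e * \<alpha>)"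
      using N(1)[of "Suc e"] by (simp add: mult.assoc)
    also have "\<dots> \<le> real p * (real (N e) + 1)"
      using N(2)[of e] by (intro mult_left_mono) auto
    finally have "real (N (Suc e)) < real (p * N e + p)" by (simp add: distrib_left)
    then show "N (Suc e) \<le> p * N e + (p - 1)" unfolding of_nat_less_iff by simp
  qed
  have dS: "N (Suc e) = p * N e + d (Suc e)" for e
    using step(1)[of e] by (simp add: d_def)
  have sums: "(\<Sum>k\<le>e. real (d k) / real p ^ k) = real (N e) / real p ^ e" for e
  proof (induction e)
    case 0
    then show ?case by (simp add: d_def N0)
  next
    case (Suc e)
    then show ?case using assms(1) by (simp add: dS add_divide_distrib)
  qed
  have lim: "(\<lambda>k. real (d k) / real p ^ k) sums \<alpha>"
    unfolding sums_def_le sums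
  proof (rule tendsto_sandwich)
    have p: "real p ^ e > 0" for e using assms(1) by simp
    show "\<forall>\<^sub>F e in sequentially. \<alpha> - (1 / real p) ^ e \<le> real (N e) / real p ^ e"
    proof (intro always_eventually allI)
      fix e
      have "\<alpha> \<le> (real (N e) + 1) / real p ^ e"
        using N(2)[of e] p[of e] by (simp add: pos_le_divide_eq mult.commute)
      then show "\<alpha> - (1 / real p) ^ e \<le> real (N e) / real p ^ e"
        by (simp add: add_divide_distrib power_one_over)
    qed
    show "\<forall>\<^sub>F e in sequentially. real (N e) / real p ^ e \<le> \<alpha>"
      using N(1) p by (intro always_eventually allI less_imp_le) (simp add: pos_divide_less_eq mult.commute)
    have "norm (1 / real p) < 1" using assms(1) by simp
    then have "(\<lambda>e. (1 / real p) ^ e) \<longlonglongrightarrow> 0" by (rule LIMSEQ_power_zero)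
    then have "(\<lambda>e. \<alpha> - (1 / real p) ^ e) \<longlonglongrightarrow> \<alpha> - 0"
      by (rule tendsto_diff[OF tendsto_const])
    then show "(\<lambda>e. \<alpha> - (1 / real p) ^ e) \<longlonglongrightarrow> \<alpha>" by simp
  qed simp
  have nt: "\<not> eventually (\<lambda>k. d k = 0) sequentially"
  proof
    assume "eventually (\<lambda>k. d k = 0) sequentially"
    then obtain K where K: "\<And>k. k \<ge> K \<Longrightarrow> d k = 0" unfolding eventually_sequentially by blast
    have "(\<lambda>k. real (d k) / real p ^ k) sums (\<Sum>k\<le>K. real (d k) / real p ^ k)"
      using K by (intro sums_finite) auto
    then have "\<alpha> = real (N K) / real p ^ K"
      using lim sums_unique2 unfolding sums by blast
    then show False using N(1)[of K] assms(1) by simp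
  qed
  have "d k \<le> p - 1" for k
    using step(2)[of "k - 1"] by (cases k) (auto simp: d_def)
  then have "nonterminating_expansion p \<alpha> d"
    unfolding nonterminating_expansion_def using lim nt by (simp add: d_def)
  then show ?thesis by blast
qed

lemma digit_expansion:
  assumes "p \<ge> 2" "0 < \<alpha>" "\<alpha> \<le> 1"
  shows "nonterminating_expansion p \<alpha> (digit p \<alpha>)"
proof -
  have "\<exists>!d. nonterminating_expansion p \<alpha> d"
    using expansion_exists[OF assms] expansion_unique[OF assms(1)] by blast
  then have "nonterminating_expansion p \<alpha> (THE d. nonterminating_expansion p \<alpha> d)"
    by (rule theI')
  moreover have "digit p \<alpha> = (THE d. nonterminating_expansion p \<alpha> d)"
    using assms(2) by (simp add: digit_def fun_eq_iff)
  ultimately show ?thesis by simp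
qed

lemma digit_zero [simp]: "digit p 0 = (\<lambda>k. 0)"
  by (simp add: digit_def fun_eq_iff)

lemma digit_at_0:
  assumes "p \<ge> 2" "0 \<le> \<alpha>" "\<alpha> \<le> 1"
  shows "digit p \<alpha> 0 = 0"
  using digit_expansion[OF assms(1) _ assms(3)] assms(2)
  by (cases "\<alpha> = 0") (auto simp: nonterminating_expansion_def)

text \<open>
  At \<open>\<alpha> = 0\<close> the strict inequality fails, but there the digits vanish.
\<close>

lemma leading_digits_digit_less:
  assumes "p \<ge> 2" "0 \<le> \<alpha>" "\<alpha> \<le> 1"
  shows "leading_digits p (digit p \<alpha>) e = 0 \<and> \<alpha> = 0 \<or>
    real (leading_digits p (digit p \<alpha>) e) < real p ^ e * \<alpha>"
proof (cases "\<alpha> = 0")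
  case True
  then show ?thesis by (simp add: leading_digits_def)
next
  case False
  then show ?thesis
    using leading_digits_bounds(1)[OF assms(1) digit_expansion] assms by simp
qed

lemma leading_digits_digit_ge:
  assumes "p \<ge> 2" "0 \<le> \<alpha>" "\<alpha> \<le> 1"
  shows "real p ^ e * \<alpha> \<le> real (leading_digits p (digit p \<alpha>) e) + 1"
proof (cases "\<alpha> = 0")
  case False
  then show ?thesis
    using leading_digits_bounds(2)[OF assms(1) digit_expansion] assms by simp
qed simp

lemma leading_digits_truncation:
  assumes "p \<ge> 1"
  shows "real (leading_digits p (digit p \<alpha>) e) = real p ^ e * truncation p e \<alpha>"
  unfolding truncation_def by (rule leading_digits_real[OF assms])

section \<open>Carry-free exponents below a given weight\<close>

text \<open>
  When the numbers \<open>k a\<close> are added in base \<open>p\<close>, nothing is carried into position \<open>i\<close>, for any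
  \<open>i\<close>.
\<close>

definition carry_free :: "nat \<Rightarrow> 'a set \<Rightarrow> ('a \<Rightarrow> nat) \<Rightarrow> bool" where
  "carry_free p B k \<longleftrightarrow> (\<forall>i. (\<Sum>a\<in>B. k a mod p ^ i) < p ^ i)"

text \<open>
  Strictness at the nonzero entries keeps every exponent \<open>\<Sum>a. k a * a\<close> below \<open>q\<close>; entries with
  \<open>r a = 0\<close> force \<open>k a = 0\<close>.
\<close>

definition strictly_below :: "'a set \<Rightarrow> ('a \<Rightarrow> nat) \<Rightarrow> real \<Rightarrow> ('a \<Rightarrow> real) \<Rightarrow> bool" where
  "strictly_below B k q r \<longleftrightarrow> (\<forall>a\<in>B. k a = 0 \<or> real (k a) < q * r a)"

text \<open>
  Truncation at \<open>e\<close> loses at most 1 in each entry after scaling by \<open>p ^ e\<close>.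
\<close>

lemma exists_carry_free_all_digits:
  assumes "p \<ge> 2" "finite B" "\<And>a. a \<in> B \<Longrightarrow> 0 \<le> r a \<and> r a \<le> 1"
    and "\<And>s. (\<Sum>a\<in>B. digit p (r a) s) \<le> p - 1"
  shows "\<exists>k. carry_free p B k \<and> strictly_below B k (real p ^ e) r \<and>
    real p ^ e * (\<Sum>a\<in>B. r a) \<le> real (\<Sum>a\<in>B. k a) + real (card B)"
proof (intro exI conjI)
  let ?k = "\<lambda>a. leading_digits p (digit p (r a)) e"
  show "carry_free p B ?k"
    unfolding carry_free_def leading_digits_def
    using sum_mod_power_less_of_digits[where p = p and A = B and e = e and D = "\<lambda>a s. digit p (r a) (e - s)"]
      assms(1,4) by simp
  show "strictly_below B ?k (real p ^ e) r"
    unfolding strictly_below_def using leading_digits_digit_less assms(1,3) by blast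
  have "real p ^ e * (\<Sum>a\<in>B. r a) \<le> (\<Sum>a\<in>B. real (?k a) + 1)"
    unfolding sum_distrib_left using leading_digits_digit_ge assms(1,3) by (intro sum_mono) blast
  then show "real p ^ e * (\<Sum>a\<in>B. r a) \<le> real (\<Sum>a\<in>B. ?k a) + real (card B)"
    by (simp add: sum.distrib)
qed

lemma exists_smaller_with_sum:
  fixes d :: "'a \<Rightarrow> nat"
  assumes "finite B" "n \<le> sum d B"
  shows "\<exists>\<delta>. (\<forall>a. \<delta> a \<le> d a) \<and> sum \<delta> B = n"
  using assms
proof (induction B arbitrary: n rule: finite_induct)
  case empty
  then show ?case by (intro exI[of _ "\<lambda>_. 0"]) simp
next
  case (insert b B)
  define t where "t = min n (d b)"
  have "n - t \<le> sum d B" using insert by (simp add: t_def)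
  then obtain \<delta> where \<delta>: "\<forall>a. \<delta> a \<le> d a" "sum \<delta> B = n - t" using insert.IH by blast
  have "sum (\<delta>(b := t)) B = sum \<delta> B" using insert.hyps by (intro sum.cong) auto
  then have "sum (\<delta>(b := t)) (insert b B) = n"
    using insert.hyps \<delta>(2) by (simp add: t_def del: fun_upd_apply add: fun_upd_same)
  moreover have "\<forall>a. (\<delta>(b := t)) a \<le> d a" using \<delta>(1) by (simp add: t_def)
  ultimately show ?case by blast
qed

lemma sum_lessThan_add:
  fixes m n :: nat and f :: "nat \<Rightarrow> nat"
  shows "(\<Sum>s<m + n. f s) = (\<Sum>s<m. f s) + (\<Sum>s<n. f (m + s))"
  by (induction n) auto

text \<open>
  At position \<open>L + 1\<close> the digits of the block add up to at least \<open>p\<close>. Lowering them to digits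
  \<open>\<delta>\<close> with sum \<open>p - 1\<close> removes the carry and makes room below one entry, \<open>a\<^sub>0\<close>, whose
  remaining digits may all be \<open>p - 1\<close>. From position \<open>L + 1\<close> on the digits then add up to
  \<open>p - 1\<close> in each position, which sums to \<open>p ^ (e - L) - 1\<close>: this is the summand \<open>1 / p ^ L\<close> of
  the bound, up to the error of 1.
\<close>

lemma exists_carry_free_at_carry:
  assumes "p \<ge> 2" "finite B" "\<And>a. a \<in> B \<Longrightarrow> 0 \<le> r a \<and> r a \<le> 1"
    and "\<And>s. s \<le> L \<Longrightarrow> (\<Sum>a\<in>B. digit p (r a) s) \<le> p - 1"
    and "\<not> (\<Sum>a\<in>B. digit p (r a) (Suc L)) \<le> p - 1"
    and "e > L"
  shows "\<exists>k. carry_free p B k \<and> strictly_below B k (real p ^ e) r \<and>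
    real p ^ e * ((\<Sum>a\<in>B. truncation p L (r a)) + 1 / real p ^ L) = real (\<Sum>a\<in>B. k a) + 1"
proof -
  obtain m where e: "e = Suc m + L"
    using assms(6) by (metis add.commute add_Suc less_iff_Suc_add)
  have p1: "p \<ge> 1" using assms(1) by simp
  define d where "d = (\<lambda>a. digit p (r a))"
  obtain \<delta> where \<delta>: "\<forall>a. \<delta> a \<le> d a (Suc L)" "sum \<delta> B = p - 1"
    using exists_smaller_with_sum[OF assms(2), of "p - 1" "\<lambda>a. d a (Suc L)"] assms(5)
    unfolding d_def by auto
  obtain a\<^sub>0 where a0: "a\<^sub>0 \<in> B" "\<delta> a\<^sub>0 < d a\<^sub>0 (Suc L)"
  proof -
    have "sum \<delta> B < (\<Sum>a\<in>B. d a (Suc L))" using \<delta>(2) assms(5) by (simp add: d_def)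
    then have "\<exists>a\<in>B. \<delta> a < d a (Suc L)" by (metis leD not_le_imp_less sum_mono)
    then show ?thesis using that by blast
  qed
  \<comment> \<open>\<open>D a s\<close> is the digit of \<open>k a\<close> at \<open>p ^ s\<close>, that is at position \<open>e - s\<close> after the point;
    position \<open>L + 1\<close> is \<open>s = m\<close>\<close>
  define D where "D = (\<lambda>a s. if s < m then (if a = a\<^sub>0 then p - 1 else 0)
      else if s = m then \<delta> a else d a (e - s))"
  define k where "k = (\<lambda>a. \<Sum>s<e. D a s * p ^ s)"
  have k: "k a = p ^ Suc m * leading_digits p (d a) L + \<delta> a * p ^ m +
      (if a = a\<^sub>0 then p ^ m - 1 else 0)" for a
  proof -
    have "(\<Sum>s<m. (p - 1) * p ^ s) = p ^ m - 1"
      using sum_power_telescope[OF p1, of m] by linarith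
    then have "(\<Sum>s<m. D a s * p ^ s) = (if a = a\<^sub>0 then p ^ m - 1 else 0)"
      by (simp add: D_def)
    moreover have "(\<Sum>s<L. D a (Suc m + s) * p ^ (Suc m + s)) = p ^ Suc m * leading_digits p (d a) L"
      unfolding leading_digits_def sum_distrib_left
      by (intro sum.cong) (auto simp: D_def e power_add mult_ac)
    moreover have "D a m = \<delta> a" by (simp add: D_def)
    ultimately show ?thesis
      unfolding k_def e sum_lessThan_add[of _ "Suc m" L] by simp
  qed
  have cf: "carry_free p B k"
    unfolding carry_free_def k_def
  proof (intro allI sum_mod_power_less_of_digits[OF p1])
    fix s
    consider "s < m" | "s = m" | "s > m" by linarith
    then show "(\<Sum>a\<in>B. D a s) \<le> p - 1"
    proof cases
      case 1
      then show ?thesis using assms(2) a0(1) by (simp add: D_def)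
    next
      case 2
      then show ?thesis using \<delta>(2) by (simp add: D_def)
    next
      case 3
      then have "(\<Sum>a\<in>B. D a s) = (\<Sum>a\<in>B. digit p (r a) (e - s))" by (simp add: D_def d_def)
      also have "\<dots> \<le> p - 1" using 3 by (intro assms(4)) (simp add: e)
      finally show ?thesis .
    qed
  qed
  \<comment> \<open>all entries stay within the first \<open>L + 1\<close> digits of \<open>r a\<close>: for \<open>a\<^sub>0\<close> the digits after
    position \<open>L + 1\<close> are paid for by the unit taken from its digit there\<close>
  have sb: "strictly_below B k (real p ^ e) r"
    unfolding strictly_below_def
  proof
    fix a assume a: "a \<in> B"
    have bound: "k a \<le> p ^ m * leading_digits p (d a) (Suc L)"
    proof (cases "a = a\<^sub>0")
      case True
      then have "Suc (\<delta> a) * p ^ m \<le> d a (Suc L) * p ^ m"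
        using a0(2) by (intro mult_right_mono) auto
      then show ?thesis using True by (simp add: k leading_digits_Suc algebra_simps)
    next
      case False
      have "\<delta> a * p ^ m \<le> d a (Suc L) * p ^ m"
        using \<delta>(1) by (intro mult_right_mono) auto
      then show ?thesis using False by (simp add: k leading_digits_Suc algebra_simps)
    qed
    have "leading_digits p (d a) (Suc L) = 0 \<or>
        real (leading_digits p (d a) (Suc L)) < real p ^ Suc L * r a"
      using leading_digits_digit_less[of p "r a" "Suc L"] assms(1,3) a unfolding d_def by blast
    then show "k a = 0 \<or> real (k a) < real p ^ e * r a"
    proof
      assume "leading_digits p (d a) (Suc L) = 0"
      then show ?thesis using bound by simp
    next
      assume lt: "real (leading_digits p (d a) (Suc L)) < real p ^ Suc L * r a"
      have "real (k a) \<le> real p ^ m * real (leading_digits p (d a) (Suc L))"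
        using bound by (metis of_nat_le_iff of_nat_mult of_nat_power)
      also have "\<dots> < real p ^ m * (real p ^ Suc L * r a)"
        using lt p1 by (intro mult_strict_left_mono) auto
      also have "\<dots> = real p ^ e * r a" by (simp add: e power_add)
      finally show ?thesis ..
    qed
  qed
  have "(\<Sum>a\<in>B. k a) + 1 = p ^ Suc m * (\<Sum>a\<in>B. leading_digits p (d a) L) + (p - 1) * p ^ m + (p ^ m - 1) + 1"
    unfolding k sum.distrib sum_distrib_left[symmetric] sum_distrib_right[symmetric] \<delta>(2)
    using assms(2) a0(1) by simp
  also have "\<dots> = p ^ Suc m * (\<Sum>a\<in>B. leading_digits p (d a) L) + p ^ Suc m"
  proof -
    have "(p - 1) * p ^ m + (p ^ m - 1) + 1 = p ^ Suc m"
      using p1 by (cases p) auto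
    then show ?thesis by simp
  qed
  finally have "real ((\<Sum>a\<in>B. k a) + 1) =
      real p ^ Suc m * (\<Sum>a\<in>B. real p ^ L * truncation p L (r a)) + real p ^ Suc m"
    using leading_digits_truncation[OF p1] by (simp add: d_def)
  also have "\<dots> = real p ^ e * ((\<Sum>a\<in>B. truncation p L (r a)) + 1 / real p ^ L)"
    using p1 by (simp add: e power_add sum_distrib_left[symmetric] distrib_left)
  finally have "real p ^ e * ((\<Sum>a\<in>B. truncation p L (r a)) + 1 / real p ^ L) = real (\<Sum>a\<in>B. k a) + 1"
    by simp
  then show ?thesis using cf sb by blast
qed

section \<open>Monomials, bracket powers and powers of ideals\<close>

lemma sum_single_keys: "(\<Sum>a\<in>Poly_Mapping.keys f. Poly_Mapping.single a (Poly_Mapping.lookup f a)) = f"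
proof (rule poly_mapping_eqI)
  fix k
  show "Poly_Mapping.lookup (\<Sum>a\<in>Poly_Mapping.keys f.
      Poly_Mapping.single a (Poly_Mapping.lookup f a)) k = Poly_Mapping.lookup f k"
    by (simp add: lookup_sum lookup_single when_def sum.delta in_keys_iff)
qed

lemma single_power:
  "(Poly_Mapping.single a c :: ('n::finite, 'k::field) mpol) ^ n =
    Poly_Mapping.single (n *s a) (c ^ n)"
proof (induction n)
  case 0
  have "0 *s a = 0" by (simp add: vec_eq_iff)
  then show ?case by simp
next
  case (Suc n)
  have "Suc n *s a = a + n *s a" by (simp add: vec_eq_iff)
  then show ?case by (simp add: Suc mult_single)
qed

lemma prod_single:
  "(\<Prod>i\<in>S. Poly_Mapping.single (u i) (c i) :: ('n::finite, 'k::field) mpol) =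
    Poly_Mapping.single (\<Sum>i\<in>S. u i) (\<Prod>i\<in>S. c i)"
  by (induction S rule: infinite_finite_induct) (auto simp: mult_single)

text \<open>
  Shape of all membership criteria below: an ideal given by an upward closed condition on exponents.
\<close>

lemma subspace_keys:
  fixes P :: "nat ^ 'n::finite \<Rightarrow> bool"
  assumes "\<And>a b. P b \<Longrightarrow> P (a + b)"
  shows "ideal.subspace {f :: ('n, 'k::field) mpol. \<forall>a\<in>Poly_Mapping.keys f. P a}"
proof (rule ideal.subspaceI)
  fix f g :: "('n, 'k) mpol"
  assume "f \<in> {f. \<forall>a\<in>Poly_Mapping.keys f. P a}" "g \<in> {f. \<forall>a\<in>Poly_Mapping.keys f. P a}"
  then show "f + g \<in> {f. \<forall>a\<in>Poly_Mapping.keys f. P a}"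
    using keys_add[of f g] by auto
next
  fix f g :: "('n, 'k) mpol"
  assume "g \<in> {f. \<forall>a\<in>Poly_Mapping.keys f. P a}"
  then show "f * g \<in> {f. \<forall>a\<in>Poly_Mapping.keys f. P a}"
    using keys_mult[of f g] assms by fastforce
qed simp

text \<open>
  The bracket power is a monomial ideal, so membership can be tested term by term.
\<close>

lemma mem_bracket_power_iff:
  fixes f :: "('n::finite, 'k::field) mpol"
  shows "f \<in> bracket_power q \<longleftrightarrow> (\<forall>a\<in>Poly_Mapping.keys f. \<exists>i. q \<le> a $ i)"
proof
  have var: "(var i ^ q :: ('n, 'k) mpol) = Poly_Mapping.single (q *s axis i 1) 1" for i :: 'n
    by (simp add: var_def monomial_def single_power)
  have keys_var: "\<exists>j. q \<le> a $ j" if "a \<in> Poly_Mapping.keys (var i ^ q :: ('n, 'k) mpol)"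
    for i :: 'n and a :: "nat ^ 'n"
  proof -
    have "a = q *s axis i 1" using that by (simp add: var)
    then show ?thesis by (intro exI[of _ i]) simp
  qed
  have "bracket_power q \<subseteq> {f :: ('n, 'k) mpol. \<forall>a\<in>Poly_Mapping.keys f. \<exists>i. q \<le> a $ i}"
    unfolding bracket_power_def
  proof (rule ideal.span_minimal)
    show "range (\<lambda>i. var i ^ q) \<subseteq> {f :: ('n, 'k) mpol. \<forall>a\<in>Poly_Mapping.keys f. \<exists>i. q \<le> a $ i}"
      using keys_var by blast
    show "ideal.subspace {f :: ('n, 'k) mpol. \<forall>a\<in>Poly_Mapping.keys f. \<exists>i. q \<le> a $ i}"
      by (rule subspace_keys) (auto intro: trans_le_add2)
  qed
  then show "f \<in> bracket_power q \<Longrightarrow> \<forall>a\<in>Poly_Mapping.keys f. \<exists>i. q \<le> a $ i" by blast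
  assume *: "\<forall>a\<in>Poly_Mapping.keys f. \<exists>i. q \<le> a $ i"
  have "(\<Sum>a\<in>Poly_Mapping.keys f. Poly_Mapping.single a (Poly_Mapping.lookup f a)) \<in> bracket_power q"
    unfolding bracket_power_def
  proof (rule ideal.span_sum)
    fix a assume "a \<in> Poly_Mapping.keys f"
    then obtain i where i: "q \<le> a $ i" using * by blast
    have "a = (a - q *s axis i 1) + q *s axis i 1"
      using i by (auto simp: vec_eq_iff axis_def)
    then have "Poly_Mapping.single a (Poly_Mapping.lookup f a) =
        Poly_Mapping.single (a - q *s axis i 1) (Poly_Mapping.lookup f a) * var i ^ q"
      unfolding var mult_single by simp
    then show "Poly_Mapping.single a (Poly_Mapping.lookup f a) \<in> ideal.span (range (\<lambda>i. var i ^ q))"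
      by (metis ideal.span_base ideal.span_scale rangeI)
  qed
  then show "f \<in> bracket_power q" by (simp add: sum_single_keys)
qed

lemma subspace_ideal_power: "ideal.subspace (ideal_power J n)"
  by (cases n) (simp_all add: ideal.subspace_span)

lemma ideal_power_mult:
  assumes "x \<in> ideal_power J m" "y \<in> ideal_power J n"
  shows "x * y \<in> ideal_power J (m + n)"
  using assms(1)
proof (induction m arbitrary: x)
  case 0
  then show ?case using ideal.subspace_scale[OF subspace_ideal_power assms(2)] by simp
next
  case (Suc m)
  have "ideal_power J (Suc m) \<subseteq> {x. x * y \<in> ideal_power J (Suc m + n)}"
    unfolding ideal_power.simps(2)[of J m]
  proof (rule ideal.span_minimal)
    show "{x * y |x y. x \<in> J \<and> y \<in> ideal_power J m} \<subseteq> {x. x * y \<in> ideal_power J (Suc m + n)}"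
    proof safe
      fix u v assume uv: "u \<in> J" "v \<in> ideal_power J m"
      have "u * (v * y) \<in> ideal_power J (Suc (m + n))"
        unfolding ideal_power.simps(2) using uv Suc.IH by (intro ideal.span_base) blast
      then show "u * v * y \<in> ideal_power J (Suc m + n)" by (simp add: mult.assoc)
    qed
    show "ideal.subspace {x. x * y \<in> ideal_power J (Suc m + n)}"
      using subspace_ideal_power[of J "Suc m + n"]
      by (intro ideal.subspaceI)
        (auto simp: distrib_right mult.assoc simp del: ideal_power.simps
          intro: ideal.subspace_0 ideal.subspace_add ideal.subspace_scale)
  qed
  then show ?case using Suc.prems by blast
qed

lemma ideal_power_1: "x \<in> J \<Longrightarrow> x \<in> ideal_power J 1"
  unfolding One_nat_def ideal_power.simps
  by (intro ideal.span_base CollectI exI[of _ x] exI[of _ 1]) simp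

lemma ideal_power_pow: "x \<in> ideal_power J m \<Longrightarrow> x ^ n \<in> ideal_power J (n * m)"
  by (induction n) (auto intro: ideal_power_mult simp del: ideal_power.simps(2))

lemma ideal_power_prod:
  assumes "finite S" "\<And>i. i \<in> S \<Longrightarrow> x i \<in> J"
  shows "(\<Prod>i\<in>S. x i ^ n i) \<in> ideal_power J (\<Sum>i\<in>S. n i)"
  using assms
proof (induction S rule: finite_induct)
  case (insert i S)
  have "x i ^ n i \<in> ideal_power J (n i)"
    using ideal_power_pow[OF ideal_power_1, of "x i" J "n i"] insert.prems by simp
  then show ?case
    using insert by (simp add: ideal_power_mult)
qed simp

lemma ideal_power_mono: "J \<subseteq> K \<Longrightarrow> ideal_power J n \<subseteq> ideal_power K n"
  by (induction n) (auto intro!: ideal.span_mono)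

text \<open>
  \<open>v\<close> lies above a nonnegative combination of \<open>A\<close> of total weight \<open>c\<close>. For \<open>c = 1\<close> this describes the
  Newton polyhedron generated by \<open>A\<close>, for general \<open>c \<ge> 0\<close> its dilate by \<open>c\<close>.
\<close>

definition dominates :: "(nat ^ 'n::finite) set \<Rightarrow> real \<Rightarrow> real ^ 'n \<Rightarrow> bool" where
  "dominates A c v \<longleftrightarrow> (\<exists>w. (\<forall>a\<in>A. 0 \<le> w a) \<and> sum w A = c \<and>
     (\<forall>i. (\<Sum>a\<in>A. real (a $ i) * w a) \<le> v $ i))"

lemma dominates_add:
  assumes "dominates A c v" "dominates A c' v'"
  shows "dominates A (c + c') (v + v')"
proof -
  obtain w w' where "\<forall>a\<in>A. 0 \<le> w a" "sum w A = c" "\<And>i. (\<Sum>a\<in>A. real (a $ i) * w a) \<le> v $ i"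
    "\<forall>a\<in>A. 0 \<le> w' a" "sum w' A = c'" "\<And>i. (\<Sum>a\<in>A. real (a $ i) * w' a) \<le> v' $ i"
    using assms unfolding dominates_def by blast
  then show ?thesis
    unfolding dominates_def
    by (intro exI[of _ "\<lambda>a. w a + w' a"]) (auto simp: sum.distrib distrib_left intro: add_mono)
qed

lemma dominates_scale:
  assumes "dominates A c v" "s \<ge> 0"
  shows "dominates A (s * c) (s *\<^sub>R v)"
proof -
  obtain w where "\<forall>a\<in>A. 0 \<le> w a" "sum w A = c" "\<And>i. (\<Sum>a\<in>A. real (a $ i) * w a) \<le> v $ i"
    using assms unfolding dominates_def by blast
  then show ?thesis
    unfolding dominates_def using assms(2)
    by (intro exI[of _ "\<lambda>a. s * w a"])
      (auto simp: sum_distrib_left[symmetric] mult.left_commute[of _ s] intro: mult_left_mono)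
qed

lemma dominates_0:
  fixes v :: "real ^ 'n::finite"
  assumes "\<And>i. 0 \<le> v $ i"
  shows "dominates A 0 v"
  unfolding dominates_def using assms by (intro exI[of _ "\<lambda>_. 0"]) auto

lemma dominates_member:
  assumes "finite A" "a \<in> A"
  shows "dominates A 1 (real_vec a)"
  unfolding dominates_def using assms
  by (intro exI[of _ "\<lambda>b. if b = a then 1 else 0"])
    (auto simp: real_vec_def if_distrib[of "(*) _"] cong: if_cong)

lemma real_vec_add: "real_vec (a + b) = real_vec a + real_vec b"
  by (simp add: real_vec_def vec_eq_iff)

lemma dominates_add_nonneg:
  fixes v v' :: "real ^ 'n::finite"
  assumes "dominates A c v" "\<And>i. 0 \<le> v' $ i"
  shows "dominates A c (v + v')"
  using dominates_add[OF assms(1) dominates_0[of v']] assms(2) by simp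

lemma subspace_dominates:
  "ideal.subspace {f :: ('n::finite, 'k::field) mpol. \<forall>a\<in>Poly_Mapping.keys f. dominates A c (real_vec a)}"
proof (rule subspace_keys)
  fix a b :: "nat ^ 'n" assume "dominates A c (real_vec b)"
  then have "dominates A c (real_vec b + real_vec a)"
    by (rule dominates_add_nonneg) (simp add: real_vec_def)
  then show "dominates A c (real_vec (a + b))" by (simp add: real_vec_add add.commute)
qed

text \<open>
  Weights add when exponents add, so the exponents in a product of \<open>c\<close> elements of \<open>J\<close>
  carry weight \<open>c\<close>.
\<close>

lemma ideal_power_dominates:
  fixes J :: "('n::finite, 'k::field) mpol set"
  assumes "\<And>f b. f \<in> J \<Longrightarrow> b \<in> Poly_Mapping.keys f \<Longrightarrow> dominates A 1 (real_vec b)"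
  shows "ideal_power J c \<subseteq> {f. \<forall>a\<in>Poly_Mapping.keys f. dominates A (real c) (real_vec a)}"
proof (induction c)
  case 0
  then show ?case by (auto intro: dominates_0 simp: real_vec_def)
next
  case (Suc c)
  show ?case
    unfolding ideal_power.simps
  proof (rule ideal.span_minimal[OF _ subspace_dominates], safe)
    fix f g a assume fg: "f \<in> J" "g \<in> ideal_power J c" and "a \<in> Poly_Mapping.keys (f * g)"
    then obtain b b' where a: "a = b + b'" "b \<in> Poly_Mapping.keys f" "b' \<in> Poly_Mapping.keys g"
      using keys_mult[of f g] by blast
    have "dominates A (1 + real c) (real_vec b + real_vec b')"
      using assms[OF fg(1) a(2)] Suc fg(2) a(3) by (intro dominates_add) auto
    then show "dominates A (real (Suc c)) (real_vec a)" by (simp add: a(1) real_vec_add)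
  qed
qed

text \<open>
  The points that dominate weight 1 form a convex set containing all the orthants that generate the
  polyhedron.
\<close>

lemma newton_polyhedron_dominates:
  fixes I :: "('n::finite, 'k::field) mpol set"
  assumes "\<And>f b. f \<in> I \<Longrightarrow> b \<in> Poly_Mapping.keys f \<Longrightarrow> dominates A 1 (real_vec b)"
  shows "newton_polyhedron I \<subseteq> {v. dominates A 1 v}"
  unfolding newton_polyhedron_def
proof (rule hull_minimal)
  show "(\<Union>a\<in>(\<Union>f\<in>I. Poly_Mapping.keys f). {real_vec a + v |v. \<forall>i. 0 \<le> v $ i}) \<subseteq> {v. dominates A 1 v}"
    using assms by (auto intro: dominates_add_nonneg)
  show "convex {v :: real ^ 'n. dominates A 1 v}"
  proof (rule convexI, safe)
    fix x y :: "real ^ 'n" and u v :: real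
    assume "dominates A 1 x" "dominates A 1 y" and uv: "0 \<le> u" "0 \<le> v" "u + v = 1"
    then have "dominates A (u * 1 + v * 1) (u *\<^sub>R x + v *\<^sub>R y)"
      by (intro dominates_add dominates_scale)
    then show "dominates A 1 (u *\<^sub>R x + v *\<^sub>R y)" using uv(3) by simp
  qed
qed

lemma term_ideal_dominates:
  fixes I :: "('n::finite, 'k::field) mpol set"
  assumes "\<And>f b. f \<in> I \<Longrightarrow> b \<in> Poly_Mapping.keys f \<Longrightarrow> dominates A 1 (real_vec b)"
    and "f \<in> term_ideal I" "b \<in> Poly_Mapping.keys f"
  shows "dominates A 1 (real_vec b)"
proof -
  have "term_ideal I \<subseteq> {f. \<forall>a\<in>Poly_Mapping.keys f. dominates A 1 (real_vec a)}"
    unfolding term_ideal_def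
    using newton_polyhedron_dominates[of I A] assms(1)
    by (intro ideal.span_minimal subspace_dominates) (auto simp: monomial_def)
  then show ?thesis using assms(2,3) by blast
qed

lemma subset_term_ideal:
  fixes I :: "('n::finite, 'k::field) mpol set"
  shows "I \<subseteq> term_ideal I"
proof
  fix f assume f: "f \<in> I"
  have "(\<Sum>a\<in>Poly_Mapping.keys f. Poly_Mapping.single a (Poly_Mapping.lookup f a)) \<in> term_ideal I"
    unfolding term_ideal_def
  proof (rule ideal.span_sum)
    fix a assume a: "a \<in> Poly_Mapping.keys f"
    have "real_vec a \<in> newton_polyhedron I"
      unfolding newton_polyhedron_def
      using f a by (intro hull_inc) (auto intro!: bexI[of _ f] bexI[of _ a] exI[of _ 0])
    then have "Poly_Mapping.single 0 (Poly_Mapping.lookup f a) * monomial a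
        \<in> ideal.span (monomial ` {a. real_vec a \<in> newton_polyhedron I})"
      by (intro ideal.span_scale ideal.span_base) auto
    then show "Poly_Mapping.single a (Poly_Mapping.lookup f a)
        \<in> ideal.span (monomial ` {a. real_vec a \<in> newton_polyhedron I})"
      by (simp add: monomial_def mult_single)
  qed
  then show "f \<in> term_ideal I" by (simp add: sum_single_keys)
qed

section \<open>Bounds, monotonicity and existence of the F-pure threshold\<close>

text \<open>
  The points of the splitting polytope, as weights on the set \<open>A\<close> of columns.
\<close>

definition packing :: "(nat ^ 'n::finite) set \<Rightarrow> (nat ^ 'n \<Rightarrow> real) \<Rightarrow> bool" where
  "packing A w \<longleftrightarrow> (\<forall>a\<in>A. 0 \<le> w a) \<and> (\<forall>i. (\<Sum>a\<in>A. real (a $ i) * w a) \<le> 1)"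

text \<open>
  The sets whose maxima are the values of \<open>nu\<close> are bounded, linearly in \<open>q\<close>. Besides bounding the
  threshold this makes \<open>Max\<close> meaningful in the definition of \<open>nu\<close>.
\<close>

definition power_bounded :: "('n::finite, 'k::field) mpol set \<Rightarrow> real \<Rightarrow> bool" where
  "power_bounded J R \<longleftrightarrow>
     (\<forall>q\<ge>1. \<forall>c. \<not> ideal_power J c \<subseteq> bracket_power q \<longrightarrow> real c \<le> real q * R)"

text \<open>
  A power not contained in the bracket power has an element with an exponent \<open>b\<close> whose
  entries are all below \<open>q\<close>. It lies above a combination \<open>w\<close> of total weight \<open>c\<close>, and dividing \<open>w\<close>
  by \<open>q\<close> gives a packing.
\<close>

lemma power_bounded_packing:
  fixes J :: "('n::finite, 'k::field) mpol set" and A :: "(nat ^ 'n) set"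
  assumes "\<And>f b. f \<in> J \<Longrightarrow> b \<in> Poly_Mapping.keys f \<Longrightarrow> dominates A 1 (real_vec b)"
    and "\<And>w. packing A w \<Longrightarrow> sum w A \<le> R"
  shows "power_bounded J R"
  unfolding power_bounded_def
proof (intro allI impI)
  fix q c :: nat
  assume q: "1 \<le> q" and c: "\<not> ideal_power J c \<subseteq> bracket_power q"
  obtain f where f: "f \<in> ideal_power J c" "f \<notin> bracket_power q" using c by blast
  obtain b where b: "b \<in> Poly_Mapping.keys f" "\<And>i. b $ i < q"
    using f(2) unfolding mem_bracket_power_iff not_le[symmetric] by blast
  then have "dominates A (real c) (real_vec b)"
    using subsetD[OF ideal_power_dominates[OF assms(1)] f(1)] by simp
  then obtain w where w: "\<forall>a\<in>A. 0 \<le> w a" "sum w A = real c"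
    "\<And>i. (\<Sum>a\<in>A. real (a $ i) * w a) \<le> real (b $ i)"
    unfolding dominates_def real_vec_def by auto
  have "sum (\<lambda>a. w a / real q) A \<le> R"
  proof (rule assms(2), unfold packing_def, intro conjI)
    show "\<forall>a\<in>A. 0 \<le> w a / real q" using w(1) by simp
    show "\<forall>i. (\<Sum>a\<in>A. real (a $ i) * (w a / real q)) \<le> 1"
    proof
      fix i
      have "(\<Sum>a\<in>A. real (a $ i) * (w a / real q)) = (\<Sum>a\<in>A. real (a $ i) * w a) / real q"
        by (simp add: sum_divide_distrib)
      also have "\<dots> \<le> 1"
        using w(3)[of i] b(2)[of i] q by (simp add: divide_le_eq)
      finally show "(\<Sum>a\<in>A. real (a $ i) * (w a / real q)) \<le> 1" .
    qed
  qed
  moreover have "sum (\<lambda>a. w a / real q) A = real c / real q"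
    using w(2) by (simp add: sum_divide_distrib[symmetric])
  ultimately show "real c \<le> real q * R" using q by (simp add: divide_le_eq mult.commute)
qed

lemma power_bounded_finite:
  assumes "power_bounded J R" "q \<ge> 1"
  shows "finite {c. \<not> ideal_power J c \<subseteq> bracket_power q}"
proof (rule finite_subset)
  show "{c. \<not> ideal_power J c \<subseteq> bracket_power q} \<subseteq> {..nat \<lfloor>real q * R\<rfloor>}"
    proof
    fix c assume "c \<in> {c. \<not> ideal_power J c \<subseteq> bracket_power q}"
    then have "real c \<le> real q * R" using assms unfolding power_bounded_def by blast
    then show "c \<in> {..nat \<lfloor>real q * R\<rfloor>}" by (simp add: le_nat_floor)
  qed
qed simp

lemma le_nu:
  assumes "power_bounded J R" "q \<ge> 1" "\<not> ideal_power J c \<subseteq> bracket_power q"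
  shows "c \<le> nu J q"
  unfolding nu_def using power_bounded_finite[OF assms(1,2)] assms(3) by (intro Max_ge) auto

lemma nu_attained:
  fixes J :: "('n::finite, 'k::field) mpol set"
  assumes "power_bounded J R" "q \<ge> 1"
  shows "\<not> ideal_power J (nu J q) \<subseteq> bracket_power q"
proof -
  have "1 \<notin> (bracket_power q :: ('n, 'k) mpol set)"
    using assms(2) by (simp add: mem_bracket_power_iff)
  then have "\<not> ideal_power J 0 \<subseteq> bracket_power q" by auto
  then have "nu J q \<in> {c. \<not> ideal_power J c \<subseteq> bracket_power q}"
    unfolding nu_def using power_bounded_finite[OF assms] by (intro Max_in) blast+
  then show ?thesis by blast
qed

lemma nu_le:
  assumes "power_bounded J R" "q \<ge> 1"
  shows "real (nu J q) \<le> real q * R"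
  using assms nu_attained[OF assms] unfolding power_bounded_def by blast

lemma CHAR_mpol: "CHAR(('n::finite, 'k::field) mpol) = CHAR('k)"
proof (rule CHAR_eqI)
  show "of_nat CHAR('k) = (0 :: ('n, 'k) mpol)"
    by (intro poly_mapping_eqI) (simp add: lookup_of_nat)
  fix n assume "of_nat n = (0 :: ('n, 'k) mpol)"
  then have "Poly_Mapping.lookup (of_nat n :: ('n, 'k) mpol) 0 = 0" by simp
  then show "CHAR('k) dvd n" by (simp add: lookup_of_nat of_nat_eq_0_iff_char_dvd)
qed

text \<open>
  Raising to the \<open>p\<close>-th power acts on each term separately, and the terms stay apart because
  multiplying exponents by \<open>p\<close> is injective.
\<close>

lemma lookup_frobenius:
  fixes f :: "('n::finite, 'k::field) mpol"
  assumes "prime p" "CHAR('k) = p"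
  shows "Poly_Mapping.lookup (f ^ p) (p *s b) = Poly_Mapping.lookup f b ^ p"
proof -
  have p: "p > 0" using assms(1) prime_gt_0_nat by blast
  have inj: "p *s a = p *s b \<longleftrightarrow> a = b" for a :: "nat ^ 'n"
    using p by (auto simp: vec_eq_iff)
  have "f ^ p = (\<Sum>a\<in>Poly_Mapping.keys f. Poly_Mapping.single a (Poly_Mapping.lookup f a)) ^ p"
    by (simp only: sum_single_keys)
  also have "\<dots> = (\<Sum>a\<in>Poly_Mapping.keys f. Poly_Mapping.single a (Poly_Mapping.lookup f a) ^ p)"
    using assms by (intro freshmans_dream_sum) (simp_all add: CHAR_mpol)
  also have "\<dots> = (\<Sum>a\<in>Poly_Mapping.keys f. Poly_Mapping.single (p *s a) (Poly_Mapping.lookup f a ^ p))"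
    by (simp only: single_power)
  finally show ?thesis
    using p by (simp add: lookup_sum lookup_single when_def inj in_keys_iff)
qed

text \<open>
  If \<open>f\<close> witnesses the value of \<open>nu\<close> at \<open>q\<close>, then \<open>f ^ p\<close> lies in the \<open>p\<close>-fold power and has
  an exponent with entries at most \<open>p * (q - 1)\<close>.
\<close>

lemma nu_mult_prime:
  fixes J :: "('n::finite, 'k::field) mpol set"
  assumes "prime p" "CHAR('k) = p" "power_bounded J R" "q \<ge> 1"
  shows "p * nu J q \<le> nu J (p * q)"
proof (rule le_nu[OF assms(3)])
  have p: "p > 0" using assms(1) prime_gt_0_nat by blast
  then show "1 \<le> p * q" using assms(4) by (simp add: Suc_le_eq)
  obtain f where f: "f \<in> ideal_power J (nu J q)" "f \<notin> bracket_power q"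
    using nu_attained[OF assms(3,4)] by blast
  then obtain b where b: "Poly_Mapping.lookup f b \<noteq> 0" "\<And>i. b $ i < q"
    unfolding mem_bracket_power_iff by (auto simp: not_le in_keys_iff)
  have "p *s b \<in> Poly_Mapping.keys (f ^ p)"
    using b(1) by (simp add: in_keys_iff lookup_frobenius[OF assms(1,2)])
  moreover have "\<not> p * q \<le> (p *s b) $ i" for i
    using b(2)[of i] p by (simp add: not_le)
  ultimately have "f ^ p \<notin> bracket_power (p * q)"
    unfolding mem_bracket_power_iff by blast
  then show "\<not> ideal_power J (p * nu J q) \<subseteq> bracket_power (p * q)"
    using ideal_power_pow[OF f(1), of p] by blast
qed

text \<open>
  By \<open>nu_mult_prime\<close> the sequence is increasing, and it is bounded. Since \<open>fpt\<close> is defined by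
  \<open>lim\<close>, convergence is what gives it its meaning.
\<close>

lemma fpt_limit:
  fixes J :: "('n::finite, 'k::field) mpol set"
  assumes "prime p" "CHAR('k) = p" "power_bounded J R"
  shows "(\<lambda>e. real (nu J (p ^ e)) / real (p ^ e)) \<longlonglongrightarrow> fpt p J"
proof -
  let ?X = "\<lambda>e. real (nu J (p ^ e)) / real (p ^ e)"
  have p: "p > 0" using assms(1) prime_gt_0_nat by blast
  have "incseq ?X"
  proof (rule incseq_SucI)
    fix e
    have "real p * real (nu J (p ^ e)) \<le> real (nu J (p ^ Suc e))"
      using nu_mult_prime[OF assms, of "p ^ e"] p
      unfolding of_nat_mult[symmetric] of_nat_le_iff by (simp add: Suc_le_eq)
    then have "real p * real (nu J (p ^ e)) / real (p ^ Suc e) \<le> ?X (Suc e)"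
      by (rule divide_right_mono) simp
    then show "?X e \<le> ?X (Suc e)" using p by simp
  qed
  moreover have "?X e \<le> R" for e
    using nu_le[OF assms(3), of "p ^ e"] p by (simp add: divide_le_eq mult.commute Suc_le_eq)
  ultimately obtain L where "?X \<longlonglongrightarrow> L" using incseq_convergent by blast
  then show ?thesis unfolding fpt_def by (simp add: limI)
qed

lemma fpt_le:
  fixes J :: "('n::finite, 'k::field) mpol set"
  assumes "prime p" "CHAR('k) = p" "power_bounded J R"
  shows "fpt p J \<le> R"
proof (rule LIMSEQ_le_const2[OF fpt_limit[OF assms]], intro exI allI impI)
  have p: "p > 0" using assms(1) prime_gt_0_nat by blast
  show "real (nu J (p ^ e)) / real (p ^ e) \<le> R" for e
    using nu_le[OF assms(3), of "p ^ e"] p by (simp add: divide_le_eq mult.commute Suc_le_eq)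
qed

lemma fpt_mono:
  fixes J K :: "('n::finite, 'k::field) mpol set"
  assumes "prime p" "CHAR('k) = p" "power_bounded J R" "power_bounded K R'" "J \<subseteq> K"
  shows "fpt p J \<le> fpt p K"
proof (rule LIMSEQ_le[OF fpt_limit[OF assms(1-3)] fpt_limit[OF assms(1,2,4)]], intro exI allI impI)
  have p: "p > 0" using assms(1) prime_gt_0_nat by blast
  fix e
  have q: "p ^ e \<ge> 1" using p by (simp add: Suc_le_eq)
  have "\<not> ideal_power K (nu J (p ^ e)) \<subseteq> bracket_power (p ^ e)"
    using nu_attained[OF assms(3) q] ideal_power_mono[OF assms(5)] by blast
  then have "nu J (p ^ e) \<le> nu K (p ^ e)" by (rule le_nu[OF assms(4) q])
  then show "real (nu J (p ^ e)) / real (p ^ e) \<le> real (nu K (p ^ e)) / real (p ^ e)"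
    by (intro divide_right_mono) auto
qed

text \<open>
  A bounded error \<open>C\<close> disappears after division by \<open>p ^ e\<close>.
\<close>

lemma fpt_ge:
  fixes J :: "('n::finite, 'k::field) mpol set"
  assumes "prime p" "CHAR('k) = p" "power_bounded J R"
    and "\<And>e. e \<ge> E \<Longrightarrow> real p ^ e * T \<le> real (nu J (p ^ e)) + C"
  shows "T \<le> fpt p J"
proof -
  have p: "p \<ge> 2" using assms(1) prime_ge_2_nat by blast
  have "norm (1 / real p) < 1" using p by simp
  then have "(\<lambda>e. (1 / real p) ^ e) \<longlonglongrightarrow> 0" by (rule LIMSEQ_power_zero)
  then have "(\<lambda>e. T - C * (1 / real p) ^ e) \<longlonglongrightarrow> T - C * 0"
    by (rule tendsto_diff[OF tendsto_const tendsto_mult_left])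
  then have lim: "(\<lambda>e. T - C * (1 / real p) ^ e) \<longlonglongrightarrow> T" by simp
  show ?thesis
  proof (rule LIMSEQ_le[OF lim fpt_limit[OF assms(1-3)]], intro exI allI impI)
    fix e assume "E \<le> e"
    then have "T \<le> (real (nu J (p ^ e)) + C) / real (p ^ e)"
      using assms(4)[of e] p by (simp add: pos_le_divide_eq mult.commute)
    then show "T - C * (1 / real p) ^ e \<le> real (nu J (p ^ e)) / real (p ^ e)"
      by (simp add: add_divide_distrib power_one_over)
  qed
qed

section \<open>The coefficient of a uniquely attained monomial\<close>

lemma power_multinomial_expansion:
  fixes f :: "('n::finite, 'k::field) mpol"
  shows "f ^ n = (\<Sum>\<kappa>\<in>compositions (Poly_Mapping.keys f) n.
    Poly_Mapping.single (\<Sum>a\<in>Poly_Mapping.keys f. \<kappa> a *s a)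
      (of_nat (multinomial (Poly_Mapping.keys f) \<kappa>) *
        (\<Prod>a\<in>Poly_Mapping.keys f. Poly_Mapping.lookup f a ^ \<kappa> a)))"
proof -
  have "f ^ n = (\<Sum>a\<in>Poly_Mapping.keys f. Poly_Mapping.single a (Poly_Mapping.lookup f a)) ^ n"
    by (simp only: sum_single_keys)
  also have "\<dots> = (\<Sum>\<kappa>\<in>compositions (Poly_Mapping.keys f) n.
      of_nat (multinomial (Poly_Mapping.keys f) \<kappa>) *
      (\<Prod>a\<in>Poly_Mapping.keys f. Poly_Mapping.single a (Poly_Mapping.lookup f a) ^ \<kappa> a))"
    by (rule multinomial_theorem) simp
  finally show ?thesis
    by (simp add: single_power prod_single mult_single flip: single_of_nat)
qed

text \<open>
  A family \<open>g\<close> records in \<open>g i a\<close> how many of the factors \<open>f i\<close> contribute their term with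
  exponent \<open>a\<close>.
\<close>

lemma prod_power_expansion:
  fixes f :: "nat \<Rightarrow> ('n::finite, 'k::field) mpol"
  shows "(\<Prod>i<t. f i ^ n i) =
    (\<Sum>g\<in>(\<Pi>\<^sub>E i\<in>{..<t}. compositions (Poly_Mapping.keys (f i)) (n i)).
      Poly_Mapping.single (\<Sum>i<t. \<Sum>a\<in>Poly_Mapping.keys (f i). g i a *s a)
        (\<Prod>i<t. of_nat (multinomial (Poly_Mapping.keys (f i)) (g i)) *
          (\<Prod>a\<in>Poly_Mapping.keys (f i). Poly_Mapping.lookup (f i) a ^ g i a)))"
proof -
  have "(\<Prod>i<t. f i ^ n i) = (\<Prod>i<t. \<Sum>\<kappa>\<in>compositions (Poly_Mapping.keys (f i)) (n i).
      Poly_Mapping.single (\<Sum>a\<in>Poly_Mapping.keys (f i). \<kappa> a *s a)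
      (of_nat (multinomial (Poly_Mapping.keys (f i)) \<kappa>) *
        (\<Prod>a\<in>Poly_Mapping.keys (f i). Poly_Mapping.lookup (f i) a ^ \<kappa> a)))"
    by (intro prod.cong refl power_multinomial_expansion)
  also have "\<dots> = (\<Sum>g\<in>(\<Pi>\<^sub>E i\<in>{..<t}. compositions (Poly_Mapping.keys (f i)) (n i)).
      \<Prod>i<t. Poly_Mapping.single (\<Sum>a\<in>Poly_Mapping.keys (f i). g i a *s a)
      (of_nat (multinomial (Poly_Mapping.keys (f i)) (g i)) *
        (\<Prod>a\<in>Poly_Mapping.keys (f i). Poly_Mapping.lookup (f i) a ^ g i a)))"
    by (rule prod_sum_PiE) (simp_all add: finite_compositions)
  finally show ?thesis by (simp only: prod_single)
qed

text \<open>
  The blocks of the exponent matrix, formed from the elements not in an earlier set, partition the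
  union.
\<close>

lemma sum_UN_new_elements:
  fixes S :: "nat \<Rightarrow> 'a set" and h :: "'a \<Rightarrow> 'b::comm_monoid_add"
  assumes "\<And>i. i < t \<Longrightarrow> finite (S i)"
  shows "sum h (\<Union>i<t. S i) = (\<Sum>i<t. sum h (S i - (\<Union>j<i. S j)))"
  using assms
proof (induction t)
  case (Suc t)
  have "(\<Union>i<Suc t. S i) = (\<Union>i<t. S i) \<union> (S t - (\<Union>i<t. S i))"
    by (auto simp: lessThan_Suc)
  also have "sum h \<dots> = sum h (\<Union>i<t. S i) + sum h (S t - (\<Union>i<t. S i))"
    using Suc.prems by (intro sum.union_disjoint) auto
  finally show ?case using Suc by simp
qed simp

lemma sum_swap_UN:
  fixes S :: "nat \<Rightarrow> 'a set" and h :: "nat \<Rightarrow> 'a \<Rightarrow> 'b::comm_monoid_add"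
  assumes "\<And>i. i < t \<Longrightarrow> finite (S i)"
  shows "(\<Sum>i<t. \<Sum>a\<in>S i. h i a) = (\<Sum>a\<in>(\<Union>i<t. S i). \<Sum>i\<in>{i\<in>{..<t}. a \<in> S i}. h i a)"
proof -
  have "(\<Sum>i<t. \<Sum>a\<in>S i. h i a) = (\<Sum>i\<in>{..<t}. \<Sum>a\<in>{a\<in>(\<Union>i<t. S i). a \<in> S i}. h i a)"
    by (intro sum.cong refl) auto
  also have "\<dots> = (\<Sum>a\<in>(\<Union>i<t. S i). \<Sum>i\<in>{i\<in>{..<t}. a \<in> S i}. h i a)"
    using assms by (intro sum.swap_restrict) auto
  finally show ?thesis .
qed

text \<open>
  The elements of the \<open>i\<close>-th block do not occur in the sets before \<open>S i\<close>, and \<open>g i\<close> has the same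
  total as \<open>k\<close> on that block. Give each \<open>a\<close> the weight \<open>blk a\<close>, the index of its block. An
  element of \<open>S i\<close> has \<open>blk a \<le> i\<close>, so replacing \<open>blk a\<close> by \<open>i\<close> can only increase the sum of
  \<open>g i a * blk a\<close>; as the column sums and the row totals of \<open>g\<close> are those of \<open>k\<close>, it does not
  change it. So each \<open>g i\<close> is supported on the \<open>i\<close>-th block, where it equals \<open>k\<close>.
\<close>

lemma triangular_families_unique:
  fixes S :: "nat \<Rightarrow> 'a set"
  assumes fin: "\<And>i. i < t \<Longrightarrow> finite (S i)"
    and g: "g \<in> (\<Pi>\<^sub>E i\<in>{..<t}. compositions (S i) (\<Sum>a\<in>S i - (\<Union>j<i. S j). k a))"
    and total: "\<And>a. a \<in> (\<Union>i<t. S i) \<Longrightarrow> (\<Sum>i\<in>{i\<in>{..<t}. a \<in> S i}. g i a) = k a"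
  shows "g = (\<lambda>i\<in>{..<t}. \<lambda>a\<in>S i. if a \<in> S i - (\<Union>j<i. S j) then k a else 0)"
proof -
  define A where "A = (\<Union>i<t. S i)"
  define B where "B = (\<lambda>i. S i - (\<Union>j<i. S j))"
  define blk where "blk = (\<lambda>a. LEAST i. a \<in> S i)"
  have blk_le: "blk a \<le> i" if "a \<in> S i" for a i
    unfolding blk_def using that by (rule Least_le)
  have blk_in: "a \<in> S (blk a)" if "a \<in> S i" for a i
    unfolding blk_def using that by (rule LeastI)
  have B_iff: "a \<in> B i \<longleftrightarrow> blk a = i" if "a \<in> S i" for a i
  proof
    assume "a \<in> B i"
    then have "\<not> blk a < i" using blk_in[OF that] by (auto simp: B_def)
    then show "blk a = i" using blk_le[OF that] by simp
  next
    assume "blk a = i"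
    then show "a \<in> B i" using blk_le[of a] that by (fastforce simp: B_def)
  qed
  have BS: "B i \<subseteq> S i" for i by (auto simp: B_def)
  have disj: "B i \<inter> B j = {}" if "i \<noteq> j" for i j
    using that B_iff BS by blast
  have n: "sum (g i) (S i) = sum k (B i)" if "i < t" for i
    using g that by (auto simp: PiE_iff compositions_def B_def)
  \<comment> \<open>the weighted sum, computed by columns, equals the one with \<open>i\<close> in place of \<open>blk a\<close>\<close>
  have "(\<Sum>i<t. \<Sum>a\<in>S i. g i a * blk a) =
      (\<Sum>a\<in>A. \<Sum>i\<in>{i\<in>{..<t}. a \<in> S i}. g i a * blk a)"
    unfolding A_def using fin by (rule sum_swap_UN)
  also have "\<dots> = (\<Sum>a\<in>A. k a * blk a)"
    using total by (simp add: sum_distrib_right[symmetric] A_def)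
  also have "\<dots> = (\<Sum>i<t. \<Sum>a\<in>B i. k a * blk a)"
    unfolding A_def B_def using fin by (rule sum_UN_new_elements)
  also have "\<dots> = (\<Sum>i<t. \<Sum>a\<in>B i. k a * i)"
    using B_iff BS by (intro sum.cong refl) (auto simp: subset_iff)
  also have "\<dots> = (\<Sum>i<t. \<Sum>a\<in>S i. g i a * i)"
    using n by (simp add: sum_distrib_right[symmetric])
  finally have "(\<Sum>i<t. \<Sum>a\<in>S i. g i a * i) = (\<Sum>i<t. \<Sum>a\<in>S i. g i a * blk a)" ..
  moreover have "(\<Sum>i<t. \<Sum>a\<in>S i. g i a * i) =
      (\<Sum>i<t. \<Sum>a\<in>S i. g i a * (i - blk a)) + (\<Sum>i<t. \<Sum>a\<in>S i. g i a * blk a)"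
    unfolding sum.distrib[symmetric] distrib_left[symmetric]
    using blk_le by (intro sum.cong refl) auto
  ultimately have "(\<Sum>i<t. \<Sum>a\<in>S i. g i a * (i - blk a)) = 0" by linarith
  then have zero: "g i a = 0" if "i < t" "a \<in> S i" "a \<notin> B i" for i a
    using that fin B_iff[OF that(2)] blk_le[OF that(2)] by fastforce
  have on_block: "g i a = k a" if "i < t" "a \<in> B i" for i a
  proof -
    have aS: "a \<in> S i" using that BS by blast
    have other: "g j a = 0" if "j < t" "a \<in> S j" "j \<noteq> i" for j
      using zero[OF that(1,2)] disj[OF that(3)] \<open>a \<in> B i\<close> by blast
    have "k a = (\<Sum>j\<in>{j\<in>{..<t}. a \<in> S j}. g j a)"
      using total[of a] that(1) aS by (metis UN_I lessThan_iff)
    also have "\<dots> = (\<Sum>j\<in>{i}. g j a)"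
      using that(1) aS other by (intro sum.mono_neutral_right) auto
    finally show ?thesis by simp
  qed
  show ?thesis
  proof (rule extensionalityI[of _ "{..<t}"])
    show "g \<in> extensional {..<t}" using g by (auto simp: PiE_iff)
    fix i assume i: "i \<in> {..<t}"
    have "g i = (\<lambda>a\<in>S i. if a \<in> B i then k a else 0)"
    proof (rule extensionalityI[of _ "S i"])
      show "g i \<in> extensional (S i)" using g i by (auto simp: PiE_iff compositions_def)
    qed (use i zero on_block in auto)
    then show "g i = (\<lambda>i\<in>{..<t}. \<lambda>a\<in>S i. if a \<in> S i - (\<Union>j<i. S j) then k a else 0) i"
      using i by (simp add: B_def)
  qed simp
qed

text \<open>
  By the uniqueness hypothesis every family contributing to the monomial has column sums
  \<open>k\<close>, and by \<open>triangular_families_unique\<close> there is only one such family, \<open>g0\<close>. Its contribution is a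
  product of multinomial coefficients prime to \<open>p\<close> and of powers of nonzero coefficients.
\<close>

lemma lookup_prod_powers_nonzero:
  fixes f :: "nat \<Rightarrow> ('n::finite, 'k::field) mpol" and k :: "nat ^ 'n \<Rightarrow> nat" and t :: nat
  defines "B \<equiv> \<lambda>i. Poly_Mapping.keys (f i) - (\<Union>j<i. Poly_Mapping.keys (f j))"
    and "A \<equiv> \<Union>i<t. Poly_Mapping.keys (f i)"
  assumes p: "prime p" "CHAR('k) = p"
    and unique: "\<And>k'. sum k' A = sum k A \<Longrightarrow> (\<Sum>a\<in>A. k' a *s a) = (\<Sum>a\<in>A. k a *s a) \<Longrightarrow>
      \<forall>a\<in>A. k' a = k a"
    and carry: "\<And>i. i < t \<Longrightarrow> carry_free p (B i) k"
  shows "Poly_Mapping.lookup (\<Prod>i<t. f i ^ sum k (B i)) (\<Sum>a\<in>A. k a *s a) \<noteq> 0"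
proof -
  define S where "S = (\<lambda>i. Poly_Mapping.keys (f i))"
  define u where "u = (\<Sum>a\<in>A. k a *s a)"
  define G where "G = (\<Pi>\<^sub>E i\<in>{..<t}. compositions (S i) (sum k (B i)))"
  define X where "X = (\<lambda>g. \<Sum>i<t. \<Sum>a\<in>S i. g i a *s a)"
  define Y where "Y = (\<lambda>g. \<Prod>i<t. of_nat (multinomial (S i) (g i)) *
          (\<Prod>a\<in>S i. Poly_Mapping.lookup (f i) a ^ g i a))"
  define g0 where "g0 = (\<lambda>i\<in>{..<t}. \<lambda>a\<in>S i. if a \<in> B i then k a else 0)"
  have fin: "finite (S i)" for i by (simp add: S_def)
  have A: "A = (\<Union>i<t. S i)" and B: "B = (\<lambda>i. S i - (\<Union>j<i. S j))"
    by (simp_all add: A_def B_def S_def)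
  have scale_sum: "(\<Sum>i\<in>M. c i) *s a = (\<Sum>i\<in>M. c i *s a)" for M :: "nat set" and c and a :: "nat ^ 'n"
    by (simp add: vec_eq_iff sum_distrib_right)
  have restrict_sum: "(\<Sum>a\<in>S i. if a \<in> B i then h a else 0) = sum h (B i)"
    for i and h :: "nat ^ 'n \<Rightarrow> 'c::comm_monoid_add"
    using fin by (subst sum.inter_restrict[symmetric]) (auto simp: B intro: arg_cong[where f = "sum h"])
  have expand: "(\<Prod>i<t. f i ^ sum k (B i)) = (\<Sum>g\<in>G. Poly_Mapping.single (X g) (Y g))"
    unfolding G_def X_def Y_def S_def by (rule prod_power_expansion)
  have only: "g = g0" if g: "g \<in> G" "X g = u" for g
  proof -
    define k' where "k' = (\<lambda>a. \<Sum>i\<in>{i\<in>{..<t}. a \<in> S i}. g i a)"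
    have "sum k' A = (\<Sum>i<t. sum (g i) (S i))"
      unfolding k'_def A using fin by (rule sum_swap_UN[symmetric])
    also have "\<dots> = (\<Sum>i<t. sum k (B i))"
      using g(1) by (intro sum.cong[OF refl]) (auto simp: G_def PiE_iff compositions_def)
    also have "\<dots> = sum k A"
      unfolding A B using fin by (rule sum_UN_new_elements[symmetric])
    finally have s: "sum k' A = sum k A" .
    have "(\<Sum>a\<in>A. k' a *s a) = X g"
      unfolding k'_def A X_def scale_sum using fin by (rule sum_swap_UN[symmetric])
    then have "\<forall>a\<in>A. k' a = k a"
      using s g(2) by (intro unique) (simp_all add: u_def)
    then show ?thesis
      unfolding g0_def B using fin g(1)
      by (intro triangular_families_unique) (auto simp: k'_def A B G_def)
  qed
  have g0_eq: "g0 i a = (if a \<in> B i then k a else 0)" if "i < t" "a \<in> S i" for i a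
    using that by (simp add: g0_def)
  have g0_sum: "(\<Sum>a\<in>S i. g0 i a) = sum k (B i)" if "i < t" for i
    using that by (simp add: g0_eq restrict_sum)
  have g0_G: "g0 \<in> G"
    unfolding G_def compositions_def PiE_iff using g0_sum by (auto simp: g0_def)
  have "X g0 = (\<Sum>i<t. \<Sum>a\<in>S i. if a \<in> B i then k a *s a else 0)"
    unfolding X_def by (intro sum.cong refl) (simp add: g0_eq vec_eq_iff)
  also have "\<dots> = u"
    unfolding restrict_sum u_def A unfolding B using fin by (rule sum_UN_new_elements[symmetric])
  finally have X0: "X g0 = u" .
  have "of_nat (multinomial (S i) (g0 i)) \<noteq> (0 :: 'k)" if "i < t" for i
  proof -
    have "(\<Sum>a\<in>S i. g0 i a mod p ^ j) < p ^ j" for j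
    proof -
      have "(\<Sum>a\<in>S i. g0 i a mod p ^ j) = (\<Sum>a\<in>S i. if a \<in> B i then k a mod p ^ j else 0)"
        using that by (intro sum.cong refl) (simp add: g0_eq)
      also have "\<dots> < p ^ j"
        unfolding restrict_sum using carry[OF that] by (simp add: carry_free_def)
      finally show ?thesis .
    qed
    then have "\<not> p dvd multinomial (S i) (g0 i)"
      using p(1) fin by (intro not_dvd_multinomial) auto
    then show ?thesis by (simp add: of_nat_eq_0_iff_char_dvd p(2))
  qed
  then have Y0: "Y g0 \<noteq> 0"
    by (auto simp: Y_def S_def in_keys_iff)
  have "finite G"
    unfolding G_def using fin by (intro finite_PiE finite_compositions) auto
  have "Poly_Mapping.lookup (\<Prod>i<t. f i ^ sum k (B i)) u = (\<Sum>g\<in>G. if X g = u then Y g else 0)"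
    unfolding expand lookup_sum lookup_single when_def by simp
  also have "\<dots> = (\<Sum>g\<in>G. if g = g0 then Y g else 0)"
  proof (rule sum.cong[OF refl])
    fix g assume "g \<in> G"
    then have "X g = u \<longleftrightarrow> g = g0" using only X0 by blast
    then show "(if X g = u then Y g else 0) = (if g = g0 then Y g else 0)" by (rule if_cong) auto
  qed
  also have "\<dots> = Y g0"
    using \<open>finite G\<close> g0_G by simp
  finally show ?thesis using Y0 by (simp add: u_def)
qed

section \<open>The splitting polytope and its maximal point\<close>

lemma keys_hat:
  "Poly_Mapping.keys (hat fs i) = Poly_Mapping.keys (fs ! i) - (\<Union>j<i. Poly_Mapping.keys (fs ! j))"
proof -
  have "Poly_Mapping.lookup (hat fs i) b =
      (if b \<in> Poly_Mapping.keys (fs ! i) - (\<Union>j<i. Poly_Mapping.keys (fs ! j))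
       then Poly_Mapping.lookup (fs ! i) b else 0)" for b
    unfolding hat_def lookup_sum lookup_single when_def by (subst sum.delta) auto
  then have "b \<in> Poly_Mapping.keys (hat fs i) \<longleftrightarrow>
      b \<in> Poly_Mapping.keys (fs ! i) - (\<Union>j<i. Poly_Mapping.keys (fs ! j))" for b
    by (simp add: in_keys_iff)
  then show ?thesis by blast
qed

text \<open>
  The set of admissible \<open>l\<close> is an initial segment of the natural numbers, and by the hypothesis on
  position 0 it is not empty. So its supremum is either infinite or its largest element; for an empty
  set it would be 0, and the second claim could fail.
\<close>

lemma carry_bound_cases:
  assumes "block_sum fs (\<lambda>c. digit p (\<rho> c) 0) i \<le> p - 1"
  shows "carry_bound p fs \<rho> i = \<infinity> \<Longrightarrow> block_sum fs (\<lambda>c. digit p (\<rho> c) e) i \<le> p - 1"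
    and "carry_bound p fs \<rho> i \<noteq> \<infinity> \<Longrightarrow> e \<le> the_enat (carry_bound p fs \<rho> i) \<Longrightarrow>
      block_sum fs (\<lambda>c. digit p (\<rho> c) e) i \<le> p - 1"
    and "carry_bound p fs \<rho> i \<noteq> \<infinity> \<Longrightarrow>
      \<not> block_sum fs (\<lambda>c. digit p (\<rho> c) (Suc (the_enat (carry_bound p fs \<rho> i)))) i \<le> p - 1"
proof -
  define Q where "Q = (\<lambda>e. block_sum fs (\<lambda>c. digit p (\<rho> c) e) i \<le> p - 1)"
  define M where "M = {l. \<forall>e\<le>l. Q e}"
  have cb: "carry_bound p fs \<rho> i = Sup (enat ` M)" by (simp add: carry_bound_def M_def Q_def)
  have "0 \<in> M" using assms by (simp add: M_def Q_def)
  {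
    assume inf: "carry_bound p fs \<rho> i = \<infinity>"
    have "Q e"
    proof (rule ccontr)
      assume "\<not> Q e"
      then have "l \<le> e" if "l \<in> M" for l
        using that unfolding M_def by (metis mem_Collect_eq nle_le)
      then have "Sup (enat ` M) \<le> enat e" by (intro Sup_least) auto
      then show False using inf cb by simp
    qed
    then show "block_sum fs (\<lambda>c. digit p (\<rho> c) e) i \<le> p - 1" by (simp add: Q_def)
  }
  define L where "L = the_enat (carry_bound p fs \<rho> i)"
  {
    assume fin: "carry_bound p fs \<rho> i \<noteq> \<infinity>"
    then have L: "Sup (enat ` M) = enat L" by (auto simp: cb L_def)
    have "finite (enat ` M)"
      using L \<open>0 \<in> M\<close> by (auto simp: Sup_enat_def split: if_splits)
    then have "Sup (enat ` M) \<in> enat ` M"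
      using \<open>0 \<in> M\<close> Max_in[of "enat ` M"] by (auto simp: Sup_enat_def)
    then have LM: "L \<in> M" using L by auto
    have "\<not> Q (Suc L)"
    proof
      assume "Q (Suc L)"
      then have "Suc L \<in> M" using LM by (auto simp: M_def le_Suc_eq)
      then have "enat (Suc L) \<le> Sup (enat ` M)" by (intro Sup_upper) auto
      then show False using L by simp
    qed
    then show "\<not> block_sum fs (\<lambda>c. digit p (\<rho> c) (Suc (the_enat (carry_bound p fs \<rho> i)))) i \<le> p - 1"
      by (simp add: Q_def L_def)
    assume "e \<le> the_enat (carry_bound p fs \<rho> i)"
    then show "block_sum fs (\<lambda>c. digit p (\<rho> c) e) i \<le> p - 1"
      using LM by (simp add: M_def Q_def L_def)
  }
qed

text \<open>
  A column is determined by its exponent, because the exponent determines the block. This identifies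
  the points of the polytope with the packings of \<open>A\<close> and turns \<open>\<rho>\<close> into a weight \<open>r\<close> on \<open>A\<close>.
\<close>

lemma maximal_point_packing:
  fixes fs :: "('n::finite, 'k::field) mpol list"
  defines "A \<equiv> \<Union>i<length fs. Poly_Mapping.keys (fs ! i)"
  assumes "maximal_points fs = {\<rho>}"
  obtains r where "\<And>i a. i < length fs \<Longrightarrow> a \<in> Poly_Mapping.keys (hat fs i) \<Longrightarrow> \<rho> (i, a) = r a"
    and "packing A r"
    and "\<And>w. packing A w \<Longrightarrow> sum w A \<le> sum r A"
    and "\<And>w. packing A w \<Longrightarrow> sum w A = sum r A \<Longrightarrow> \<forall>a\<in>A. w a = r a"
proof -
  define blk where "blk = (\<lambda>a. LEAST i. a \<in> Poly_Mapping.keys (fs ! i))"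
  define r where "r = (\<lambda>a. \<rho> (blk a, a))"
  have blk: "blk a = i" if "a \<in> Poly_Mapping.keys (hat fs i)" for a i
    unfolding blk_def using that
    by (intro Least_equality) (auto simp: keys_hat not_less[symmetric])
  have in_hat: "\<exists>i<length fs. a \<in> Poly_Mapping.keys (hat fs i)" if "a \<in> A" for a
  proof -
    obtain i where i: "i < length fs" "a \<in> Poly_Mapping.keys (fs ! i)" using \<open>a \<in> A\<close> by (auto simp: A_def)
    have "a \<in> Poly_Mapping.keys (fs ! blk a)" unfolding blk_def using i(2) by (rule LeastI)
    moreover have "a \<notin> Poly_Mapping.keys (fs ! j)" if "j < blk a" for j
      using that unfolding blk_def by (rule not_less_Least)
    moreover have "blk a \<le> i" unfolding blk_def using i(2) by (rule Least_le)
    ultimately show ?thesis using i(1) by (intro exI[of _ "blk a"]) (auto simp: keys_hat)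
  qed
  have hat_A: "a \<in> A" if "i < length fs" "a \<in> Poly_Mapping.keys (hat fs i)" for i a
    using that by (auto simp: A_def keys_hat)
  have sum_columns: "(\<Sum>c\<in>columns fs. h c) = (\<Sum>a\<in>A. h (blk a, a))" for h :: "_ \<Rightarrow> real"
  proof -
    have "(\<Sum>c\<in>columns fs. h c) = (\<Sum>i<length fs. \<Sum>a\<in>Poly_Mapping.keys (hat fs i). h (i, a))"
      unfolding columns_def by (subst sum.Sigma) (auto simp: case_prod_beta)
    also have "\<dots> = (\<Sum>i<length fs. \<Sum>a\<in>Poly_Mapping.keys (hat fs i). h (blk a, a))"
      by (intro sum.cong refl) (simp add: blk)
    also have "\<dots> = (\<Sum>a\<in>A. h (blk a, a))"
      unfolding A_def keys_hat by (rule sum_UN_new_elements[symmetric]) simp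
    finally show ?thesis .
  qed
  have arg: "is_arg_max (\<lambda>\<gamma>. \<Sum>c\<in>columns fs. \<gamma> c) (\<lambda>\<gamma>. \<gamma> \<in> splitting_polytope fs) \<gamma> \<longleftrightarrow> \<gamma> = \<rho>" for \<gamma>
    using assms(2) unfolding maximal_points_def by blast
  have \<rho>: "\<rho> \<in> splitting_polytope fs"
    and max: "\<And>\<gamma>. \<gamma> \<in> splitting_polytope fs \<Longrightarrow> (\<Sum>c\<in>columns fs. \<gamma> c) \<le> (\<Sum>c\<in>columns fs. \<rho> c)"
    using arg[of \<rho>] unfolding is_arg_max_def by (auto simp: not_less)
  define lift where "lift = (\<lambda>w. \<lambda>c\<in>columns fs. w (snd c) :: real)"
  have lift_at: "lift w (blk a, a) = w a" if "a \<in> A" for w a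
    using in_hat[OF that] blk by (auto simp: lift_def columns_def)
  have lift_sum: "(\<Sum>c\<in>columns fs. lift w c) = sum w A" for w
    unfolding sum_columns by (intro sum.cong refl) (simp add: lift_at)
  have lift_polytope: "lift w \<in> splitting_polytope fs" if "packing A w" for w
  proof -
    have "(\<Sum>c\<in>columns fs. exponent_matrix i c * lift w c) \<le> 1" for i
      using that unfolding sum_columns packing_def
      by (simp add: lift_at exponent_matrix_def cong: sum.cong)
    moreover have "lift w \<in> columns fs \<rightarrow>\<^sub>E {0..}"
      using that hat_A by (auto simp: lift_def packing_def columns_def)
    ultimately show ?thesis by (simp add: splitting_polytope_def)
  qed
  have r_sum: "(\<Sum>c\<in>columns fs. \<rho> c) = sum r A" by (simp add: sum_columns r_def)
  show thesis
  proof
    show "\<rho> (i, a) = r a" if "a \<in> Poly_Mapping.keys (hat fs i)" for i a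
      using blk[OF that] by (simp add: r_def)
    have "0 \<le> r a" if a: "a \<in> A" for a
    proof -
      obtain i where "i < length fs" "a \<in> Poly_Mapping.keys (hat fs i)" using in_hat[OF a] by blast
      then have "(blk a, a) \<in> columns fs" using blk by (auto simp: columns_def)
      then show ?thesis using \<rho> by (auto simp: splitting_polytope_def r_def)
    qed
    moreover have "(\<Sum>a\<in>A. real (a $ i) * r a) \<le> 1" for i
      using \<rho> unfolding splitting_polytope_def sum_columns by (simp add: exponent_matrix_def r_def)
    ultimately show "packing A r" by (simp add: packing_def)
    show "sum w A \<le> sum r A" if "packing A w" for w
      using max[OF lift_polytope[OF that]] by (simp add: lift_sum r_sum)
    show "\<forall>a\<in>A. w a = r a" if "packing A w" "sum w A = sum r A" for w
    proof -
      have "lift w = \<rho>"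
        using lift_polytope[OF that(1)] max that(2)
        unfolding arg[symmetric] is_arg_max_def lift_sum r_sum by (auto simp: not_less)
      then show ?thesis using lift_at by (auto simp: r_def)
    qed
  qed
qed

text \<open>
  If \<open>k'\<close> has the same total and yields the same monomial as \<open>k\<close>, then shifting \<open>r\<close> by
  \<open>(k' - k) / q\<close> keeps it a packing with the same total weight: it changes neither
  \<open>\<Sum>a. r a * a\<close> nor the total, and \<open>k \<le> q * r\<close> keeps it nonnegative. Uniqueness of the
  maximal packing makes the shift zero.
\<close>

lemma sum_le_nu:
  fixes fs :: "('n::finite, 'k::field) mpol list" and I :: "('n, 'k) mpol set"
  defines "A \<equiv> \<Union>i<length fs. Poly_Mapping.keys (fs ! i)"
  assumes p: "prime p" "CHAR('k) = p" and q: "q \<ge> 1"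
    and I: "\<And>i. i < length fs \<Longrightarrow> fs ! i \<in> I" "power_bounded I R"
    and r: "packing A r" "\<And>w. packing A w \<Longrightarrow> sum w A = sum r A \<Longrightarrow> \<forall>a\<in>A. w a = r a"
    and below: "strictly_below A k (real q) r"
    and carry: "\<And>i. i < length fs \<Longrightarrow> carry_free p (Poly_Mapping.keys (hat fs i)) k"
  shows "sum k A \<le> nu I q"
proof (rule le_nu[OF I(2) q])
  have fin: "finite A" by (auto simp: A_def)
  have le: "real (k a) \<le> real q * r a" if "a \<in> A" for a
    using below r(1) that by (fastforce simp: strictly_below_def packing_def)
  have unique: "\<forall>a\<in>A. k' a = k a"
    if s: "sum k' A = sum k A" and u: "(\<Sum>a\<in>A. k' a *s a) = (\<Sum>a\<in>A. k a *s a)" for k'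
  proof -
    define w where "w = (\<lambda>a. r a + (real (k' a) - real (k a)) / real q)"
    have "packing A w"
      unfolding packing_def
    proof (intro conjI ballI allI)
      fix a assume "a \<in> A"
      then have "real (k a) / real q \<le> r a"
        using le[of a] q by (simp add: divide_le_eq mult.commute)
      moreover have "0 \<le> real (k' a) / real q" by simp
      ultimately show "0 \<le> w a" unfolding w_def diff_divide_distrib by linarith
    next
      fix i
      have "(\<Sum>a\<in>A. k' a * a $ i) = (\<Sum>a\<in>A. k a * a $ i)"
        using arg_cong[OF u, of "\<lambda>v. v $ i"] by (simp add: sum_component)
      then have "(\<Sum>a\<in>A. real (k' a) * real (a $ i)) = (\<Sum>a\<in>A. real (k a) * real (a $ i))"
        by (metis (no_types, lifting) of_nat_mult of_nat_sum sum.cong)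
      then have "(\<Sum>a\<in>A. real (a $ i) * ((real (k' a) - real (k a)) / real q)) = 0"
        by (simp add: right_diff_distrib sum_subtractf mult.commute flip: sum_divide_distrib)
      then show "(\<Sum>a\<in>A. real (a $ i) * w a) \<le> 1"
        using r(1) by (simp add: w_def distrib_left sum.distrib packing_def)
    qed
    moreover have "sum w A = sum r A"
      using s by (simp add: w_def sum.distrib sum_subtractf flip: sum_divide_distrib of_nat_sum)
    ultimately have "\<forall>a\<in>A. w a = r a" by (rule r(2))
    then show ?thesis using q by (simp add: w_def)
  qed
  let ?g = "\<Prod>i<length fs. (fs ! i) ^ sum k (Poly_Mapping.keys (hat fs i))"
  let ?u = "\<Sum>a\<in>A. k a *s a"
  have "?u \<in> Poly_Mapping.keys ?g"
    unfolding in_keys_iff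
    unfolding A_def keys_hat
    using carry unfolding keys_hat by (intro lookup_prod_powers_nonzero[OF p] unique[unfolded A_def])
  \<comment> \<open>each row of \<open>q * r\<close> is at most \<open>q\<close>, and \<open>k\<close> is strictly smaller wherever it contributes\<close>
  moreover have "\<not> q \<le> ?u $ i" for i
  proof -
    have "(\<Sum>a\<in>A. real (k a) * real (a $ i)) < real q"
    proof (cases "\<exists>a\<in>A. k a > 0 \<and> a $ i > 0")
      case True
      then obtain a where a: "a \<in> A" "k a > 0" "a $ i > 0" by blast
      have "(\<Sum>a\<in>A. real (k a) * real (a $ i)) < (\<Sum>a\<in>A. real q * r a * real (a $ i))"
        using fin
      proof (rule sum_strict_mono_ex1)
        show "\<forall>a\<in>A. real (k a) * real (a $ i) \<le> real q * r a * real (a $ i)"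
          using le by (simp add: mult_right_mono)
        have "real (k a) < real q * r a" using below a by (auto simp: strictly_below_def)
        then show "\<exists>a\<in>A. real (k a) * real (a $ i) < real q * r a * real (a $ i)"
          using a by (intro bexI[of _ a]) auto
      qed
      also have "\<dots> = real q * (\<Sum>a\<in>A. real (a $ i) * r a)"
        by (simp add: sum_distrib_left mult_ac)
      also have "\<dots> \<le> real q * 1"
        using r(1) by (intro mult_left_mono) (auto simp: packing_def)
      finally show ?thesis by simp
    next
      case False
      then have "(\<Sum>a\<in>A. real (k a) * real (a $ i)) = 0" by (intro sum.neutral) auto
      then show ?thesis using q by simp
    qed
    moreover have "real (?u $ i) = (\<Sum>a\<in>A. real (k a) * real (a $ i))" by (simp add: sum_component)
    ultimately show ?thesis by linarith
  qed
  ultimately have "?g \<notin> bracket_power q"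
    using mem_bracket_power_iff[THEN iffD1, THEN bspec, of ?g q ?u] by blast
  moreover have "?g \<in> ideal_power I (\<Sum>i<length fs. sum k (Poly_Mapping.keys (hat fs i)))"
    using I(1) by (intro ideal_power_prod) auto
  moreover have "(\<Sum>i<length fs. sum k (Poly_Mapping.keys (hat fs i))) = sum k A"
    unfolding A_def keys_hat by (rule sum_UN_new_elements[symmetric]) simp
  ultimately show "\<not> ideal_power I (sum k A) \<subseteq> bracket_power q" by auto
qed

section \<open>The F-pure threshold of an ideal and its term ideal\<close>

lemma span_dominates:
  fixes fs :: "('n::finite, 'k::field) mpol list"
  assumes "f \<in> ideal.span (set fs)" "b \<in> Poly_Mapping.keys f"
  shows "dominates (\<Union>i<length fs. Poly_Mapping.keys (fs ! i)) 1 (real_vec b)"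
proof -
  let ?A = "\<Union>i<length fs. Poly_Mapping.keys (fs ! i)"
  have "set fs \<subseteq> {f. \<forall>a\<in>Poly_Mapping.keys f. dominates ?A 1 (real_vec a)}"
    by (auto simp: in_set_conv_nth intro!: dominates_member)
  then have "ideal.span (set fs) \<subseteq> {f. \<forall>a\<in>Poly_Mapping.keys f. dominates ?A 1 (real_vec a)}"
    by (intro ideal.span_minimal subspace_dominates)
  then show ?thesis using assms by blast
qed

text \<open>
  Here it matters that the generators lie in the maximal ideal: an exponent with a positive entry
  has weight at most 1, and so has a nonterminating expansion or is 0.
\<close>

lemma packing_le_1:
  assumes "finite A" "packing A r" "a \<in> A" "1 \<le> a $ i"
  shows "r a \<le> 1"
proof -
  have r: "0 \<le> r b" if "b \<in> A" for b using assms(2) that by (simp add: packing_def)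
  have "r a \<le> real (a $ i) * r a"
    using assms(4) r[OF assms(3)] mult_right_mono[of 1 "real (a $ i)" "r a"] by simp
  also have "\<dots> \<le> (\<Sum>b\<in>A. real (b $ i) * r b)"
    using assms(1,3) r by (intro member_le_sum) auto
  also have "\<dots> \<le> 1" using assms(2) by (simp add: packing_def)
  finally show ?thesis .
qed

lemma max_ideal_eq: "max_ideal = bracket_power 1"
  unfolding max_ideal_def bracket_power_def power_one_right ..

text \<open>
  The contribution of the \<open>i\<close>-th generator to the bound, so that both parts of the theorem
  follow from one inequality.
\<close>

definition block_bound :: "nat \<Rightarrow> ('n::finite, 'k::field) mpol list \<Rightarrow> (nat \<times> (nat ^ 'n) \<Rightarrow> real) \<Rightarrow> nat \<Rightarrow> real" where
  "block_bound p fs \<rho> i =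
     (if carry_bound p fs \<rho> i = \<infinity> then block_sum fs \<rho> i
      else let L = the_enat (carry_bound p fs \<rho> i) in
        block_sum fs (\<lambda>c. truncation p L (\<rho> c)) i + 1 / real p ^ L)"

text \<open>
  The error \<open>card B + 1\<close> covers both cases, and it is independent of \<open>e\<close>.
\<close>

lemma exists_block_exponents:
  fixes fs :: "('n::finite, 'k::field) mpol list" and i :: nat
  defines "B \<equiv> Poly_Mapping.keys (hat fs i)"
  assumes p: "p \<ge> 2" and r: "\<And>a. a \<in> B \<Longrightarrow> \<rho> (i, a) = r a" "\<And>a. a \<in> B \<Longrightarrow> 0 \<le> r a \<and> r a \<le> 1"
    and e: "carry_bound p fs \<rho> i \<noteq> \<infinity> \<Longrightarrow> the_enat (carry_bound p fs \<rho> i) < e"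
  shows "\<exists>k. carry_free p B k \<and> strictly_below B k (real p ^ e) r \<and>
    real p ^ e * block_bound p fs \<rho> i \<le> real (sum k B) + real (card B + 1)"
proof -
  have fin: "finite B" by (simp add: B_def)
  have block: "block_sum fs (\<lambda>c. h (\<rho> c)) i = (\<Sum>a\<in>B. h (r a))" for h :: "real \<Rightarrow> 'c::comm_monoid_add"
    unfolding block_sum_def B_def[symmetric] using r(1) by (intro sum.cong) auto
  have block_digit: "block_sum fs (\<lambda>c. digit p (\<rho> c) s) i = (\<Sum>a\<in>B. digit p (r a) s)" for s
    by (rule block)
  have "block_sum fs (\<lambda>c. digit p (\<rho> c) 0) i \<le> p - 1"
    unfolding block_digit using digit_at_0[OF p] r(2) by simp
  note digits = carry_bound_cases[OF this, unfolded block_digit]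
  show ?thesis
  proof (cases "carry_bound p fs \<rho> i = \<infinity>")
    case True
    obtain k where k: "carry_free p B k" "strictly_below B k (real p ^ e) r"
      "real p ^ e * (\<Sum>a\<in>B. r a) \<le> real (\<Sum>a\<in>B. k a) + real (card B)"
      using exists_carry_free_all_digits[where r = r, OF p fin r(2) digits(1)[OF True]] by blast
    have "block_bound p fs \<rho> i = (\<Sum>a\<in>B. r a)"
      using True block[of "\<lambda>x. x"] by (simp add: block_bound_def)
    then show ?thesis using k by (intro exI[of _ k]) simp
  next
    case False
    define L where "L = the_enat (carry_bound p fs \<rho> i)"
    obtain k where k: "carry_free p B k" "strictly_below B k (real p ^ e) r"
      "real p ^ e * ((\<Sum>a\<in>B. truncation p L (r a)) + 1 / real p ^ L) = real (\<Sum>a\<in>B. k a) + 1"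
      using exists_carry_free_at_carry[where r = r and L = L and e = e, OF p fin r(2)]
        digits(2,3)[OF False] e[OF False] unfolding L_def by blast
    have "block_bound p fs \<rho> i = (\<Sum>a\<in>B. truncation p L (r a)) + 1 / real p ^ L"
      using False block[of "truncation p L"]
      unfolding block_bound_def Let_def L_def[symmetric] if_not_P[OF False] by simp
    then show ?thesis using k by (intro exI[of _ k]) simp
  qed
qed

theorem theorem1:
  fixes p :: nat
    and I :: "('n::finite, 'k::field) mpol set"
    and fs :: "('n, 'k) mpol list"
    and \<rho> :: "nat \<times> (nat ^ 'n) \<Rightarrow> real"
  assumes "prime p" and "CHAR('k) = p"
    and "ideal.subspace I" and "I \<noteq> {0}" and "I \<subseteq> max_ideal"
    and "minimal_generators fs I"
    and "maximal_points fs = {\<rho>}"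
  shows "(finite_indices p fs \<rho> = {} \<longrightarrow> fpt p I = fpt p (term_ideal I)) \<and>
    (finite_indices p fs \<rho> \<noteq> {} \<longrightarrow>
       fpt p I \<ge>
         (\<Sum>i \<in> {..<length fs} - finite_indices p fs \<rho>. block_sum fs \<rho> i) +
         (\<Sum>i \<in> finite_indices p fs \<rho>.
            block_sum fs (\<lambda>c. truncation p (the_enat (carry_bound p fs \<rho> i)) (\<rho> c)) i
              + 1 / real p ^ the_enat (carry_bound p fs \<rho> i)))"
proof -
  note p = assms(1,2)
  have p2: "p \<ge> 2" using p(1) prime_ge_2_nat by blast
  define t where "t = length fs"
  define A where "A = (\<Union>i<t. Poly_Mapping.keys (fs ! i))"
  define B where "B = (\<lambda>i. Poly_Mapping.keys (hat fs i))"
  define F where "F = finite_indices p fs \<rho>"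
  have finA: "finite A" by (simp add: A_def)
  have span: "ideal.span (set fs) = I" using assms(6) by (simp add: minimal_generators_def)
  then have gen: "fs ! i \<in> I" if "i < t" for i
    using that by (metis ideal.span_base nth_mem t_def)
  obtain r where r: "\<And>i a. i < t \<Longrightarrow> a \<in> B i \<Longrightarrow> \<rho> (i, a) = r a"
    and pack: "packing A r"
    and max: "\<And>w. packing A w \<Longrightarrow> sum w A \<le> sum r A"
    and unique: "\<And>w. packing A w \<Longrightarrow> sum w A = sum r A \<Longrightarrow> \<forall>a\<in>A. w a = r a"
    using maximal_point_packing[OF assms(7)] unfolding A_def B_def t_def by blast
  have r01: "0 \<le> r a \<and> r a \<le> 1" if a: "a \<in> A" for a
  proof -
    obtain i where i: "i < t" "a \<in> Poly_Mapping.keys (fs ! i)" using a by (auto simp: A_def)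
    then have "fs ! i \<in> bracket_power 1" using gen assms(5) by (auto simp: max_ideal_eq)
    then obtain j where "1 \<le> a $ j" using i(2) unfolding mem_bracket_power_iff by blast
    then have "r a \<le> 1" by (rule packing_le_1[OF finA pack a])
    then show ?thesis using pack a by (simp add: packing_def)
  qed
  have domI: "dominates A 1 (real_vec b)" if "f \<in> I" "b \<in> Poly_Mapping.keys f" for f b
    using that span span_dominates unfolding A_def t_def by blast
  have bdI: "power_bounded I (sum r A)"
    using domI max by (rule power_bounded_packing)
  have bdT: "power_bounded (term_ideal I) (sum r A)"
    using term_ideal_dominates[OF domI] max by (rule power_bounded_packing)
  have B_A: "B i \<subseteq> A" if "i < t" for i
    using that by (auto simp: A_def B_def keys_hat)
  have sum_blocks: "sum h A = (\<Sum>i<t. sum h (B i))" for h :: "nat ^ 'n \<Rightarrow> 'c::comm_monoid_add"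
    unfolding A_def B_def keys_hat by (rule sum_UN_new_elements) simp
  \<comment> \<open>from \<open>E\<close> on, \<open>e\<close> exceeds every finite carry bound\<close>
  define E where "E = Suc (\<Sum>i<t. the_enat (carry_bound p fs \<rho> i))"
  have lower: "(\<Sum>i<t. block_bound p fs \<rho> i) \<le> fpt p I"
  proof (rule fpt_ge[OF p bdI])
    fix e assume "E \<le> e"
    have "\<exists>k. carry_free p (B i) k \<and> strictly_below (B i) k (real p ^ e) r \<and>
        real p ^ e * block_bound p fs \<rho> i \<le> real (sum k (B i)) + real (card (B i) + 1)" if i: "i < t" for i
      unfolding B_def
    proof (rule exists_block_exponents[OF p2])
      have "the_enat (carry_bound p fs \<rho> i) \<le> (\<Sum>i<t. the_enat (carry_bound p fs \<rho> i))"
        using i by (intro member_le_sum) auto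
      then show "the_enat (carry_bound p fs \<rho> i) < e" using \<open>E \<le> e\<close> by (simp add: E_def)
    qed (use r[OF i] r01 B_A[OF i] in \<open>auto simp: B_def\<close>)
    then obtain K where K: "\<And>i. i < t \<Longrightarrow> carry_free p (B i) (K i)"
      "\<And>i. i < t \<Longrightarrow> strictly_below (B i) (K i) (real p ^ e) r"
      "\<And>i. i < t \<Longrightarrow> real p ^ e * block_bound p fs \<rho> i \<le> real (sum (K i) (B i)) + real (card (B i) + 1)"
      by metis
    \<comment> \<open>the blocks are disjoint, so the choices made on them combine to one vector\<close>
    define k where "k = (\<lambda>a. K (LEAST i. a \<in> Poly_Mapping.keys (fs ! i)) a)"
    have k: "k a = K i a" if "a \<in> B i" for i a
    proof -
      have "(LEAST i. a \<in> Poly_Mapping.keys (fs ! i)) = i"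
        using that by (intro Least_equality) (auto simp: B_def keys_hat not_less[symmetric])
      then show ?thesis by (simp add: k_def)
    qed
    have carry: "carry_free p (B i) k" if "i < t" for i
      using K(1)[OF that] by (simp add: carry_free_def k cong: sum.cong)
    have below: "strictly_below A k (real p ^ e) r"
      unfolding strictly_below_def
    proof
      fix a assume "a \<in> A"
      have "\<exists>i<t. a \<in> B i"
      proof (rule ccontr)
        assume none: "\<not> (\<exists>i<t. a \<in> B i)"
        have "(\<Sum>b\<in>A. if b = a then 1 else (0::nat)) = (\<Sum>i<t. \<Sum>b\<in>B i. if b = a then 1 else 0)"
          by (rule sum_blocks)
        also have "\<dots> = 0" using none by (intro sum.neutral ballI) auto
        finally show False using \<open>a \<in> A\<close> finA by simp
      qed
      then obtain i where "i < t" "a \<in> B i" by blast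
      then show "k a = 0 \<or> real (k a) < real p ^ e * r a"
        using K(2)[of i] k by (auto simp: strictly_below_def)
    qed
    have "sum k A \<le> nu I (p ^ e)"
      unfolding A_def t_def
    proof (rule sum_le_nu[OF p _ _ bdI pack[unfolded A_def t_def] unique[unfolded A_def t_def]])
      show "1 \<le> p ^ e" using p2 by simp
      show "fs ! i \<in> I" if "i < length fs" for i
        using that unfolding t_def[symmetric] by (rule gen)
      show "strictly_below (\<Union>i<length fs. Poly_Mapping.keys (fs ! i)) k (real (p ^ e)) r"
        using below unfolding A_def t_def of_nat_power .
      show "carry_free p (Poly_Mapping.keys (hat fs i)) k" if "i < length fs" for i
        using that unfolding t_def[symmetric] using carry by (simp only: B_def)
    qed
    have "real p ^ e * (\<Sum>i<t. block_bound p fs \<rho> i) \<le>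
        (\<Sum>i<t. real (sum (K i) (B i)) + real (card (B i) + 1))"
      unfolding sum_distrib_left
    proof (rule sum_mono)
      fix i assume "i \<in> {..<t}"
      then have "i < t" by simp
      then show "real p ^ e * block_bound p fs \<rho> i \<le> real (sum (K i) (B i)) + real (card (B i) + 1)"
        by (rule K(3))
    qed
    also have "\<dots> = real (sum k A) + real (\<Sum>i<t. card (B i) + 1)"
      unfolding sum_blocks sum.distrib of_nat_sum by (simp add: k sum.distrib cong: sum.cong)
    finally show "real p ^ e * (\<Sum>i<t. block_bound p fs \<rho> i) \<le>
        real (nu I (p ^ e)) + real (\<Sum>i<t. card (B i) + 1)"
      using \<open>sum k A \<le> nu I (p ^ e)\<close> by linarith
  qed
  have F_iff: "i \<in> F \<longleftrightarrow> i < t \<and> carry_bound p fs \<rho> i \<noteq> \<infinity>" for i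
    unfolding F_def finite_indices_def t_def by simp
  have split: "(\<Sum>i<t. block_bound p fs \<rho> i) =
      (\<Sum>i\<in>{..<t} - F. block_sum fs \<rho> i) +
      (\<Sum>i\<in>F. block_sum fs (\<lambda>c. truncation p (the_enat (carry_bound p fs \<rho> i)) (\<rho> c)) i
        + 1 / real p ^ the_enat (carry_bound p fs \<rho> i))" (is "_ = sum ?g _ + sum ?h _")
  proof -
    have "block_bound p fs \<rho> i = ?g i" if "i \<in> {..<t} - F" for i
    proof -
      have "carry_bound p fs \<rho> i = \<infinity>" using that F_iff[of i] by simp
      then show ?thesis unfolding block_bound_def by (rule if_P)
    qed
    moreover have "block_bound p fs \<rho> i = ?h i" if "i \<in> F" for i
    proof -
      have "carry_bound p fs \<rho> i \<noteq> \<infinity>" using that F_iff[of i] by simp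
      then show ?thesis unfolding block_bound_def Let_def by (rule if_not_P)
    qed
    moreover have "F \<subseteq> {..<t}" using F_iff by blast
    ultimately show ?thesis
      by (simp only: sum.subset_diff[of F "{..<t}"] finite_lessThan cong: sum.cong)
  qed
  show ?thesis
  proof (intro conjI impI)
    assume "finite_indices p fs \<rho> = {}"
    then have "F = {}" by (simp only: F_def)
    have "block_sum fs \<rho> i = sum r (B i)" if "i < t" for i
      using r[OF that] unfolding block_sum_def B_def by (rule sum.cong[OF refl])
    then have "(\<Sum>i<t. block_bound p fs \<rho> i) = (\<Sum>i<t. sum r (B i))"
      unfolding split \<open>F = {}\<close> by simp
    then have "sum r A \<le> fpt p I" using lower by (simp add: sum_blocks)
    moreover have "fpt p (term_ideal I) \<le> sum r A" by (rule fpt_le[OF p bdT])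
    moreover have "fpt p I \<le> fpt p (term_ideal I)"
      by (rule fpt_mono[OF p bdI bdT subset_term_ideal])
    ultimately show "fpt p I = fpt p (term_ideal I)" by linarith
  next
    show "(\<Sum>i \<in> {..<length fs} - finite_indices p fs \<rho>. block_sum fs \<rho> i) +
         (\<Sum>i \<in> finite_indices p fs \<rho>.
            block_sum fs (\<lambda>c. truncation p (the_enat (carry_bound p fs \<rho> i)) (\<rho> c)) i
              + 1 / real p ^ the_enat (carry_bound p fs \<rho> i)) \<le> fpt p I"
      using lower[unfolded split] unfolding F_def t_def .
  qed
qed

end
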